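(* Let $\mathbb{F}_q$ be a finite field with $q$ elements, let $n>1$, $1\le d<n$ be integers, let $\alpha\in\mathbb{F}_{q^n}$ be a root of an irreducible polynomial of degree $n$ over $\mathbb{F}_q$, and let $0<\delta<1$. Assume $(n+d-1)\leq q^{d/2}(1-\delta)$. Then every non-trivial eigenvalue $\lambda$ of the adjacency operator $M$ of $G_d(n,q,\alpha)$ satisfies $$|\lambda|\leq \frac{q^d}{d}(1-\delta)\leq |P_d|(1-\delta)=\lambda_{triv}(1-\delta).$$ In particular, $G_d(n,q,\alpha)$ is an expander graph.
   Context: $\Gamma_f=\mathbb{F}_{q^n}^*$. A polynomial of positive degree is primary if it is a power of an irreducible polynomial. $P_d$ is the set of monic primary polynomials of degree $d$ in $\mathbb{F}_q[x]$, $E_d=\{g(\alpha):g\in P_d\}$, and $H$ is the subgroup of $\Gamma_f$ generated by $E_d$. $G_d(n,q,\alpha)$ is the directed Cayley graph on $\Gamma_f$ with edges $\beta_1\to\beta_2$ whenever $\beta_2/\beta_1\in E_d$. Its adjacency operator acts on functions $h:\Gamma_f\to\mathbb{C}$ by $M(h)(x)=\sum_{g\in P_d}h(xg(\alpha))$. For each multiplicative character $\chi$ of $\Gamma_f$, $\chi$ is an eigenvector with eigenvalue $\lambda_d(\chi)=\sum_{g\in P_d}\chi(g(\alpha))$, and these characters form an eigenbasis. The trivial eigenvalue is $\lambda_{triv}=|P_d|$ (arising from $\chi$ trivial on $H$); a non-trivial eigenvalue is $\lambda_d(\chi)$ for a character $\chi$ that is non-trivial on $H$. *)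

theory Defs
  imports
    "HOL-Algebra.Generated_Groups"
    "Graph_Theory.Digraph"
    "Jordan_Normal_Form.Char_Poly"
    "HOL-Library.Cardinality"
    Complex_Main
begin

text \<open>
  The extension of finite fields is a homomorphism \<open>\<iota> :: 'a \<Rightarrow> 'b\<close> of finite fields
  (locale \<^locale>\<open>field_hom\<close>), with \<open>q = CARD('a)\<close> and \<open>q ^ n = CARD('b)\<close>.
\<close>

definition mult_grp :: "'x::field monoid" where
  "mult_grp = \<lparr>carrier = UNIV - {0}, monoid.mult = (*), one = 1\<rparr>"

definition primary_poly :: "'a::field poly \<Rightarrow> bool" where
  "primary_poly g \<longleftrightarrow> degree g > 0 \<and> (\<exists>p k. irreducible p \<and> g = p ^ k)"

definition primary_polys :: "nat \<Rightarrow> 'a::field poly set" where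
  "primary_polys d = {g. lead_coeff g = 1 \<and> degree g = d \<and> primary_poly g}"

definition eval_at :: "('a::field \<Rightarrow> 'b::field) \<Rightarrow> 'b \<Rightarrow> 'a poly \<Rightarrow> 'b" where
  "eval_at \<iota> \<alpha> g = poly (map_poly \<iota> g) \<alpha>"

definition conn_set :: "('a::field \<Rightarrow> 'b::field) \<Rightarrow> 'b \<Rightarrow> nat \<Rightarrow> 'b set" where
  "conn_set \<iota> \<alpha> d = eval_at \<iota> \<alpha> ` primary_polys d"

definition conn_subgroup :: "('a::field \<Rightarrow> 'b::field) \<Rightarrow> 'b \<Rightarrow> nat \<Rightarrow> 'b set" where
  "conn_subgroup \<iota> \<alpha> d = generate mult_grp (conn_set \<iota> \<alpha> d)"

definition cayley_digraph :: "('a::field \<Rightarrow> 'b::field) \<Rightarrow> 'b \<Rightarrow> nat \<Rightarrow> ('b, 'b \<times> 'b) pre_digraph" where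
  "cayley_digraph \<iota> \<alpha> d =
     \<lparr>verts = carrier mult_grp,
      arcs = {(\<beta>1, \<beta>2). \<beta>1 \<in> carrier mult_grp \<and> \<beta>2 \<in> carrier mult_grp \<and> \<beta>2 / \<beta>1 \<in> conn_set \<iota> \<alpha> d},
      tail = fst, head = snd\<rparr>"

definition adj_op :: "('a::field \<Rightarrow> 'b::field) \<Rightarrow> 'b \<Rightarrow> nat \<Rightarrow> ('b \<Rightarrow> complex) \<Rightarrow> 'b \<Rightarrow> complex" where
  "adj_op \<iota> \<alpha> d h x = (\<Sum>g\<in>primary_polys d. h (x * eval_at \<iota> \<alpha> g))"

text \<open>
  Multiplicative characters. Elements of \<^const>\<open>hom\<close> are unconstrained at \<open>0\<close>, so only
  their values on the group may be used.
\<close>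

definition mult_characters :: "('b::field \<Rightarrow> complex) set" where
  "mult_characters = hom mult_grp mult_grp"

definition char_eigenvalue :: "('a::field \<Rightarrow> 'b::field) \<Rightarrow> 'b \<Rightarrow> nat \<Rightarrow> ('b \<Rightarrow> complex) \<Rightarrow> complex \<Rightarrow> bool" where
  "char_eigenvalue \<iota> \<alpha> d \<chi> \<mu> \<longleftrightarrow> \<chi> \<in> mult_characters \<and>
     (\<forall>x\<in>carrier mult_grp. adj_op \<iota> \<alpha> d \<chi> x = \<mu> * \<chi> x)"

definition trivial_eigenvalue :: "('a::field \<Rightarrow> 'b::field) \<Rightarrow> 'b \<Rightarrow> nat \<Rightarrow> complex \<Rightarrow> bool" where
  "trivial_eigenvalue \<iota> \<alpha> d \<mu> \<longleftrightarrow>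
     (\<exists>\<chi>. char_eigenvalue \<iota> \<alpha> d \<chi> \<mu> \<and> (\<forall>x\<in>conn_subgroup \<iota> \<alpha> d. \<chi> x = 1))"

definition nontrivial_eigenvalue :: "('a::field \<Rightarrow> 'b::field) \<Rightarrow> 'b \<Rightarrow> nat \<Rightarrow> complex \<Rightarrow> bool" where
  "nontrivial_eigenvalue \<iota> \<alpha> d \<mu> \<longleftrightarrow>
     (\<exists>\<chi>. char_eigenvalue \<iota> \<alpha> d \<chi> \<mu> \<and> (\<exists>x\<in>conn_subgroup \<iota> \<alpha> d. \<chi> x \<noteq> 1))"

definition digraph_adj :: "('v, 'e) pre_digraph \<Rightarrow> ('v \<Rightarrow> complex) \<Rightarrow> 'v \<Rightarrow> complex" where
  "digraph_adj G h v = (\<Sum>e\<in>out_arcs G v. h (head G e))"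

text \<open>
  Spectral expansion of a finite \<open>k\<close>-regular digraph. The eigenvalue \<open>k\<close> of the constant
  function is discarded exactly once, by restricting to the functions of sum zero; a disconnected
  graph is therefore not an expander for any \<open>\<delta> > 0\<close>.
\<close>

definition spectral_expander :: "real \<Rightarrow> ('v, 'e) pre_digraph \<Rightarrow> bool" where
  "spectral_expander \<delta> G \<longleftrightarrow> 0 < \<delta> \<and> fin_digraph G \<and> verts G \<noteq> {} \<and>
     (\<exists>k>0. (\<forall>v\<in>verts G. out_degree G v = k \<and> in_degree G v = k) \<and>
       (\<forall>\<mu> h. (\<exists>v\<in>verts G. h v \<noteq> 0) \<and> (\<Sum>v\<in>verts G. h v) = 0 \<and>
               (\<forall>v\<in>verts G. digraph_adj G h v = \<mu> * h v)
             \<longrightarrow> cmod \<mu> \<le> (1 - \<delta>) * real k))"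


text \<open>
  Consistency of the definitions: the eigenvalue at \<open>\<chi>\<close> is the character sum over the
  primary polynomials, the trivial eigenvalue is their number, and \<^const>\<open>adj_op\<close> is the
  adjacency operator of the graph.
\<close>

lemma char_eigenvalue_iff:
  assumes "\<And>g. g \<in> primary_polys d \<Longrightarrow> eval_at \<iota> \<alpha> g \<noteq> 0"
  shows "char_eigenvalue \<iota> \<alpha> d \<chi> \<mu> \<longleftrightarrow>
    \<chi> \<in> mult_characters \<and> \<mu> = (\<Sum>g\<in>primary_polys d. \<chi> (eval_at \<iota> \<alpha> g))"
proof -
  have "adj_op \<iota> \<alpha> d \<chi> x = (\<Sum>g\<in>primary_polys d. \<chi> (eval_at \<iota> \<alpha> g)) * \<chi> x \<and> \<chi> x \<noteq> 0"
    if "\<chi> \<in> mult_characters" "x \<noteq> 0" for x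
    using that assms unfolding adj_op_def sum_distrib_right
    by (intro conjI sum.cong) (auto simp: mult_characters_def hom_def mult_grp_def Pi_def)
  thus ?thesis
    unfolding char_eigenvalue_def by (auto simp: mult_grp_def) (metis mult_cancel_right zero_neq_one)
qed

lemma trivial_eigenvalue_iff:
  fixes \<iota> :: "'a::field \<Rightarrow> 'b::field"
  assumes "\<And>g. g \<in> primary_polys d \<Longrightarrow> eval_at \<iota> \<alpha> g \<noteq> 0"
  shows "trivial_eigenvalue \<iota> \<alpha> d \<mu> \<longleftrightarrow> \<mu> = of_nat (card (primary_polys d :: 'a::field poly set))"
    (is "_ \<longleftrightarrow> \<mu> = ?c")
proof -
  have 1: "(\<Sum>g\<in>primary_polys d. \<chi> (eval_at \<iota> \<alpha> g)) = ?c"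
    if "\<forall>x\<in>conn_subgroup \<iota> \<alpha> d. \<chi> x = (1::complex)" for \<chi>
  proof -
    have "\<chi> (eval_at \<iota> \<alpha> g) = 1" if "g \<in> primary_polys d" for g
      using that \<open>\<forall>x\<in>_. _\<close> by (auto simp: conn_subgroup_def conn_set_def intro: generate.incl)
    thus ?thesis by simp
  qed
  have "(\<lambda>_. 1) \<in> mult_characters"
    by (auto simp: mult_characters_def hom_def mult_grp_def)
  note iff = char_eigenvalue_iff[of d \<iota> \<alpha>, OF assms]
  show ?thesis
  proof
    show "trivial_eigenvalue \<iota> \<alpha> d \<mu> \<Longrightarrow> \<mu> = ?c"
      using 1 by (auto simp: trivial_eigenvalue_def iff)
    show "\<mu> = ?c \<Longrightarrow> trivial_eigenvalue \<iota> \<alpha> d \<mu>"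
      using \<open>(\<lambda>_. 1) \<in> _\<close> unfolding trivial_eigenvalue_def
      by (intro exI[of _ "\<lambda>_. 1"]) (simp add: iff)
  qed
qed

lemma no_small_annihilator:
  fixes f r :: "'a::field poly" and \<iota> :: "'a \<Rightarrow> 'b::field"
  assumes "field_hom \<iota>" "irreducible f" "eval_at \<iota> \<alpha> f = 0" "r \<noteq> 0" "eval_at \<iota> \<alpha> r = 0"
  shows "degree f \<le> degree r"
proof -
  interpret field_hom \<iota> by fact
  interpret mp: map_poly_comm_ring_hom \<iota> ..
  define r0 where "r0 = arg_min degree (\<lambda>r. r \<noteq> 0 \<and> eval_at \<iota> \<alpha> r = 0)"
  have r0: "r0 \<noteq> 0" "eval_at \<iota> \<alpha> r0 = 0"
    and min: "\<And>s. s \<noteq> 0 \<Longrightarrow> eval_at \<iota> \<alpha> s = 0 \<Longrightarrow> degree r0 \<le> degree s"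
    using arg_min_nat_lemma[of "\<lambda>r. r \<noteq> 0 \<and> eval_at \<iota> \<alpha> r = 0" r degree] assms
    unfolding r0_def by auto
  have "eval_at \<iota> \<alpha> f = eval_at \<iota> \<alpha> (f div r0) * eval_at \<iota> \<alpha> r0 + eval_at \<iota> \<alpha> (f mod r0)"
    unfolding eval_at_def poly_mult[symmetric] poly_add[symmetric] mp.hom_mult[symmetric] mp.hom_add[symmetric]
    by simp
  hence "eval_at \<iota> \<alpha> (f mod r0) = 0" using assms r0 by simp
  hence "f mod r0 = 0"
    using min[of "f mod r0"] degree_mod_less[of r0 f] r0 by force
  then obtain s where s: "f = r0 * s" by (metis mod_eq_0_iff_dvd dvdE)
  have "\<not> is_unit r0"
  proof
    assume "is_unit r0"
    then obtain t where "r0 * t = 1" by (metis dvdE)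
    hence "poly (map_poly \<iota> r0) \<alpha> * poly (map_poly \<iota> t) \<alpha> = 1"
      by (metis mp.hom_mult mp.hom_one poly_1 poly_mult)
    thus False using r0 by (simp add: eval_at_def)
  qed
  hence "is_unit s" using irreducibleD[OF assms(2) s] by blast
  hence "degree s = 0" by (simp add: is_unit_iff_degree assms poly_dvd_1)
  have "f \<noteq> 0" using assms(2) by auto
  hence "degree f = degree r0" using s \<open>degree s = 0\<close> by (auto simp: degree_mult_eq)
  thus ?thesis using min assms by simp
qed

lemma eval_at_primary_polys:
  fixes f :: "'a::field poly" and \<iota> :: "'a \<Rightarrow> 'b::field"
  assumes "field_hom \<iota>" "irreducible f" "eval_at \<iota> \<alpha> f = 0" "d < degree f"
  shows "g \<in> primary_polys d \<Longrightarrow> eval_at \<iota> \<alpha> g \<noteq> 0"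
    and "inj_on (eval_at \<iota> \<alpha>) (primary_polys d)"
proof -
  show "eval_at \<iota> \<alpha> g \<noteq> 0" if "g \<in> primary_polys d"
    using no_small_annihilator[OF assms(1-3), of g] assms(4) that
    by (cases "g = 0") (auto simp: primary_polys_def primary_poly_def)
  interpret field_hom \<iota> by fact
  interpret mp: map_poly_comm_ring_hom \<iota> ..
  show "inj_on (eval_at \<iota> \<alpha>) (primary_polys d)"
  proof (rule inj_onI)
    fix g h assume *: "g \<in> primary_polys d" "h \<in> primary_polys d" "eval_at \<iota> \<alpha> g = eval_at \<iota> \<alpha> h"
    have "eval_at \<iota> \<alpha> (g - h) = 0"
      using * by (simp add: eval_at_def hom_distribs)
    moreover have "degree (g - h) < degree f"
      using * assms(4) degree_diff_le_max[of g h] by (auto simp: primary_polys_def)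
    ultimately show "g = h"
      using no_small_annihilator[OF assms(1-3), of "g - h"] by force
  qed
qed

lemma digraph_adj_cayley_digraph:
  fixes f :: "'a::field poly" and \<iota> :: "'a \<Rightarrow> 'b::field"
  assumes "field_hom \<iota>" "irreducible f" "eval_at \<iota> \<alpha> f = 0" "d < degree f"
    and x: "x \<in> carrier mult_grp"
  shows "digraph_adj (cayley_digraph \<iota> \<alpha> d) h x = adj_op \<iota> \<alpha> d h x"
proof -
  note * = eval_at_primary_polys[OF assms(1-4)]
  have "out_arcs (cayley_digraph \<iota> \<alpha> d) x = (\<lambda>g. (x, x * eval_at \<iota> \<alpha> g)) ` primary_polys d"
    using x *(1) by (force simp: out_arcs_def cayley_digraph_def conn_set_def mult_grp_def field_simps)
  moreover have "inj_on (\<lambda>g. (x, x * eval_at \<iota> \<alpha> g)) (primary_polys d)"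
    using x *(2) by (auto simp: inj_on_def mult_grp_def)
  ultimately show ?thesis
    by (simp add: digraph_adj_def adj_op_def sum.reindex cayley_digraph_def)
qed

end

theory Submission
  imports
    "HOL-Algebra.Algebraic_Closure_Type"
    "HOL-Algebra.Multiplicative_Group"
    "HOL-Algebra.Sylow"
    Defs
begin

text \<open>
  Let \<open>\<psi> g = \<chi> (g(\<alpha>))\<close>, a nontrivial Dirichlet character modulo \<open>f\<close>. Weighting the primary polynomial
  \<open>p\<^bsup>k\<^esup>\<close> by \<open>deg p\<close> turns the eigenvalue into the \<open>d\<close>-th coefficient \<open>S\<^sub>d\<close> of \<open>u L'/L\<close>, where the \<open>L\<close>-series
  \<open>L = \<Sum> \<psi>(g) u\<^bsup>deg g\<^esup>\<close> is a polynomial of degree less than \<open>n\<close>; hence \<open>S\<^sub>d\<close> is minus the sum of the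
  \<open>d\<close>-th powers of at most \<open>n - 1\<close> numbers \<open>w\<close>. These satisfy \<open>\<bar>w\<bar> \<le> \<surd>q\<close> as soon as
  \<open>S\<^bsub>2nk\<^esub> = O(q\<^bsup>nk\<^esup>)\<close> for \<open>k \<rightarrow> \<infinity>\<close>. Written as a sum over the field with \<open>Q = q\<^bsup>2nk\<^esup>\<close> elements,
  \<open>S\<^bsub>2nk\<^esub>\<close> is a \<open>\<chi>\<close>-weighted count of the points \<open>b\<close> at which a fixed polynomial with a simple root,
  raised to the power \<open>(Q - 1)/(q\<^sup>n - 1)\<close>, takes each value, and Stepanov's method bounds each count by
  \<open>Q/(q\<^sup>n - 1) + O(\<surd>Q)\<close>. Proper prime powers contribute at most \<open>d q\<^bsup>d/2\<^esup>\<close>, so that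
  \<open>d \<bar>\<lambda>\<bar> \<le> (n - 1 + d) q\<^bsup>d/2\<^esup> \<le> q\<^sup>d (1 - \<delta>)\<close>. The bound holds for every nontrivial character of the
  whole group, and these are exactly what an eigenvector of sum zero can involve.
\<close>

hide_const (open) Polynomials.degree Polynomials.lead_coeff up_ring.monom up_ring.coeff
  Divisibility.irreducible Divisibility.prime Coset.order

section \<open>Power sums and linear systems\<close>

lemma sum_list_map_single:
  fixes f :: "'b \<Rightarrow> 'c::semiring_1"
  assumes "\<And>v. v \<in> set vs \<Longrightarrow> v \<noteq> w \<Longrightarrow> f v = 0"
  shows "(\<Sum>v\<leftarrow>vs. f v) = of_nat (count_list vs w) * f w"
  using assms by (induction vs) (auto simp: algebra_simps)

text \<open>Cancellation in the power sums cannot hide a large \<open>w\<close>: weighting shifted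
  power sums by the coefficients of a polynomial that vanishes at all other entries leaves only the
  \<open>w\<close>-term, so \<open>cmod w ^ k\<close> is at most a constant times
  \<open>B ^ k\<close> for every \<open>k \<ge> 1\<close>.\<close>

lemma power_sums_bound_imp_norm_bound:
  fixes ws :: "complex list"
  assumes S: "\<And>k. k \<ge> 1 \<Longrightarrow> cmod (\<Sum>w\<leftarrow>ws. w ^ k) \<le> C * B ^ k"
    and B: "B > 0" and w: "w \<in> set ws"
  shows "cmod w \<le> B"
proof (rule ccontr)
  assume "\<not> cmod w \<le> B"
  hence wB: "cmod w > B" by simp
  define P where "P = (\<Prod>v\<in>set ws - {w}. [:-v, 1:])"
  have P0: "poly P v = 0" if "v \<in> set ws" "v \<noteq> w" for v
    using that by (auto simp: P_def poly_prod)
  have Pw: "poly P w \<noteq> 0"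
    by (auto simp: P_def poly_prod)
  define m where "m = count_list ws w"
  have m: "m > 0" using w by (simp add: m_def count_list_0_iff flip: neq0_conv)
  define E where "E = (\<Sum>i\<le>degree P. cmod (coeff P i) * (C * B ^ i)) / (of_nat m * cmod (poly P w))"
  have *: "cmod w ^ k \<le> E * B ^ k" if "k \<ge> 1" for k
  proof -
    have "(\<Sum>i\<le>degree P. coeff P i * (\<Sum>v\<leftarrow>ws. v ^ (k + i))) = (\<Sum>v\<leftarrow>ws. v ^ k * poly P v)"
      by (induction ws) (simp_all add: poly_altdef sum_distrib_left sum.distrib algebra_simps power_add)
    also have "\<dots> = of_nat m * (w ^ k * poly P w)"
      unfolding m_def by (rule sum_list_map_single) (simp add: P0)
    finally have "of_nat m * cmod w ^ k * cmod (poly P w) = cmod (\<Sum>i\<le>degree P. coeff P i * (\<Sum>v\<leftarrow>ws. v ^ (k + i)))"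
      by (simp add: norm_mult norm_power)
    also have "\<dots> \<le> (\<Sum>i\<le>degree P. cmod (coeff P i) * (C * B ^ (k + i)))"
      using that by (intro sum_norm_le) (auto simp: norm_mult intro!: mult_left_mono S)
    also have "\<dots> = (\<Sum>i\<le>degree P. cmod (coeff P i) * (C * B ^ i)) * B ^ k"
      by (simp add: sum_distrib_right sum_distrib_left power_add algebra_simps)
    finally show ?thesis
      using m Pw unfolding E_def by (simp add: field_simps)
  qed
  obtain k where k: "E < (cmod w / B) ^ k"
    using real_arch_pow[of "cmod w / B" E] wB B by (auto simp: field_simps)
  \<comment> \<open>The exponent found may be 0, where \<open>*\<close> says nothing, so it is
    raised by one.\<close>
  have "(cmod w / B) ^ k \<le> (cmod w / B) ^ Suc k"
    using wB B by (intro power_increasing) (auto simp: field_simps)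
  with k have "E < (cmod w / B) ^ Suc k" by simp
  hence "E * B ^ Suc k < cmod w ^ Suc k"
    using B by (simp add: field_simps del: power_Suc)
  with *[of "Suc k"] show False by simp
qed

text \<open>The series with coefficients \<open>c\<close> is a polynomial with constant term 1,
  hence a product of factors \<open>1 - w X\<close>. The recursion says that \<open>X\<close> times
  its logarithmic derivative has the coefficients \<open>S\<close>, and for a product this is a sum
  over the factors.\<close>

lemma newton_recursion_roots:
  fixes c S :: "nat \<Rightarrow> complex"
  assumes c0: "c 0 = 1" and cn: "\<And>d. d \<ge> n \<Longrightarrow> c d = 0"
    and newton: "\<And>d. of_nat d * c d = (\<Sum>i=1..d. S i * c (d - i))"
  shows "\<exists>ws. length ws \<le> n - 1 \<and> (\<forall>d\<ge>1. S d = - (\<Sum>w\<leftarrow>ws. w ^ d))"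
proof -
  define p where "p = Poly (map c [0..<n])"
  have coeff_p: "coeff p i = c i" for i
    by (cases "i < n") (auto simp: p_def nth_default_def cn)
  have deg_p: "degree p \<le> n - 1"
    by (rule degree_le) (auto simp: coeff_p cn)
  \<comment> \<open>Factoring the reflected polynomial gives the reciprocal roots \<open>w\<close>
    directly; reflecting back loses nothing because the constant term \<open>c 0\<close> is
    nonzero.\<close>
  obtain ws where ws: "smult (lead_coeff (reflect_poly p)) (\<Prod>w\<leftarrow>ws. [:-w, 1:]) = reflect_poly p"
    "length ws = degree (reflect_poly p)"
    using fundamental_theorem_algebra_factorized by blast
  have len: "length ws \<le> n - 1"
    using ws(2) degree_reflect_poly_le[of p] deg_p by linarith
  have "p \<noteq> 0" using coeff_p[of 0] c0 by auto
  have "lead_coeff (reflect_poly p) = 1"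
    using coeff_p[of 0] c0 by (simp add: coeff_reflect_poly)
  hence "reflect_poly (reflect_poly p) = reflect_poly (\<Prod>w\<leftarrow>ws. [:-w, 1:])"
    using ws(1) by simp
  hence p_eq: "p = (\<Prod>w\<leftarrow>ws. [:1, -w:])"
    using coeff_p[of 0] c0 by (simp add: reflect_poly_prod_list o_def reflect_poly_pCons' monom_altdef)
  define L where "L = Abs_fps c"
  \<comment> \<open>\<open>T w\<close> is \<open>X\<close> times the logarithmic derivative of
    \<open>1 - w X\<close>.\<close>
  define T where "T = (\<lambda>w::complex. - Abs_fps (\<lambda>d. if d = 0 then 0 else w ^ d))"
  have L_p: "L = fps_of_poly p"
    by (simp add: fps_eq_iff L_def coeff_p)
  have T1: "fps_X * fps_deriv (fps_of_poly [:1, -w:]) = fps_of_poly [:1, -w:] * T w" for w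
  proof (rule fps_ext)
    fix d
    show "fps_nth (fps_X * fps_deriv (fps_of_poly [:1, -w:])) d = fps_nth (fps_of_poly [:1, -w:] * T w) d"
      by (cases d rule: nat.exhaust; cases "d - 1") (auto simp: T_def fps_of_poly_pCons algebra_simps)
  qed
  have "fps_X * fps_deriv (fps_of_poly (\<Prod>w\<leftarrow>ws. [:1, -w:]))
      = fps_of_poly (\<Prod>w\<leftarrow>ws. [:1, -w:]) * (\<Sum>w\<leftarrow>ws. T w)"
  proof (induction ws)
    case (Cons w ws)
    have "fps_X * fps_deriv (A * B) = (fps_X * fps_deriv A) * B + A * (fps_X * fps_deriv B)" for A B :: "complex fps"
      by (simp add: algebra_simps)
    thus ?case
      by (simp only: list.map prod_list.Cons sum_list.Cons fps_of_poly_mult T1 Cons.IH) (simp only: algebra_simps)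
  qed simp
  hence "fps_X * fps_deriv L = L * (\<Sum>w\<leftarrow>ws. T w)"
    by (simp add: L_p p_eq)
  moreover have "fps_X * fps_deriv L = L * Abs_fps (\<lambda>d. if d = 0 then 0 else S d)"
  proof (rule fps_ext)
    fix d
    have "fps_nth (L * Abs_fps (\<lambda>d. if d = 0 then 0 else S d)) d = (\<Sum>i=0..d. (if i = 0 then 0 else S i) * c (d - i))"
      by (subst mult.commute) (simp add: fps_mult_nth L_def)
    also have "\<dots> = (\<Sum>i=1..d. S i * c (d - i))"
      by (intro sum.mono_neutral_cong_right) auto
    also have "\<dots> = fps_nth (fps_X * fps_deriv L) d"
      unfolding newton[symmetric] by (cases d) (simp_all add: L_def)
    finally show "fps_nth (fps_X * fps_deriv L) d = fps_nth (L * Abs_fps (\<lambda>d. if d = 0 then 0 else S d)) d" ..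
  qed
  moreover have "L \<noteq> 0"
    using c0 by (auto simp: L_def fps_eq_iff intro!: exI[of _ 0])
  ultimately have S: "Abs_fps (\<lambda>d. if d = 0 then 0 else S d) = (\<Sum>w\<leftarrow>ws. T w)"
    by simp
  have "fps_nth (\<Sum>w\<leftarrow>vs. T w) d = - (\<Sum>w\<leftarrow>vs. w ^ d)" if "d \<ge> 1" for d vs
    using that by (induction vs) (auto simp: T_def)
  hence "S d = - (\<Sum>w\<leftarrow>ws. w ^ d)" if "d \<ge> 1" for d
    using arg_cong[OF S, of "\<lambda>f. fps_nth f d"] that by simp
  thus ?thesis using len by blast
qed

text \<open>Gaussian elimination, one equation at a time: a pivot unknown \<open>v\<close> is solved
  for in equation \<open>B\<close>, which leaves one unknown and one equation fewer.\<close>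

lemma homogeneous_system_nontrivial:
  fixes m :: "nat \<Rightarrow> 'u \<Rightarrow> 'k::field"
  assumes "finite U" "B < card U"
  shows "\<exists>x. (\<exists>u\<in>U. x u \<noteq> 0) \<and> (\<forall>r<B. (\<Sum>u\<in>U. m r u * x u) = 0)"
  using assms
proof (induction B arbitrary: U m)
  case 0
  thus ?case by (intro exI[of _ "\<lambda>_. 1"]) (auto simp: card_gt_0_iff)
next
  case (Suc B)
  show ?case
  proof (cases "\<forall>u\<in>U. m B u = 0")
    case True
    from Suc.IH[of U m] Suc.prems obtain x where
      "\<exists>u\<in>U. x u \<noteq> 0" "\<forall>r<B. (\<Sum>u\<in>U. m r u * x u) = 0" by auto
    with True show ?thesis by (intro exI[of _ x]) (auto simp: less_Suc_eq)
  next
    case False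
    then obtain v where v: "v \<in> U" "m B v \<noteq> 0" by blast
    define V where "V = U - {v}"
    have V: "finite V" "v \<notin> V" "U = insert v V" using v Suc.prems by (auto simp: V_def)
    have "B < card V" using V Suc.prems by simp
    from Suc.IH[OF V(1) this, of "\<lambda>r u. m r u - m r v * m B u / m B v"] obtain x where
      x: "\<exists>u\<in>V. x u \<noteq> 0" "\<And>r. r < B \<Longrightarrow> (\<Sum>u\<in>V. (m r u - m r v * m B u / m B v) * x u) = 0" by auto
    define y where "y = x(v := - (\<Sum>u\<in>V. m B u * x u) / m B v)"
    have y: "(\<Sum>u\<in>U. m r u * y u) = (\<Sum>u\<in>V. m r u * x u) - m r v * (\<Sum>u\<in>V. m B u * x u) / m B v" for r
    proof -
      have "(\<Sum>u\<in>V. m r u * y u) = (\<Sum>u\<in>V. m r u * x u)"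
        using V by (intro sum.cong) (auto simp: y_def)
      thus ?thesis using V by (simp add: y_def)
    qed
    have "(\<Sum>u\<in>U. m r u * y u) = 0" if "r < Suc B" for r
    proof (cases "r = B")
      case True
      thus ?thesis unfolding y using v by simp
    next
      case False
      hence "(\<Sum>u\<in>V. (m r u - m r v * m B u / m B v) * x u) = 0" using x(2) that by simp
      thus ?thesis unfolding y
        by (simp add: algebra_simps sum_subtractf sum_divide_distrib sum_distrib_left)
    qed
    moreover have "\<exists>u\<in>U. y u \<noteq> 0" using x(1) V by (auto simp: y_def)
    ultimately show ?thesis by blast
  qed
qed

text \<open>The nonzero term of least order at \<open>a\<close> stands alone, and all others are
  divisible by a higher power of \<open>X - a\<close>, so nothing can cancel it.\<close>

lemma order_sum_distinct:
  fixes p :: "'u \<Rightarrow> 'k::field poly"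
  assumes "finite U" "u \<in> U" "p u \<noteq> 0"
    and "\<And>v w. v \<in> U \<Longrightarrow> w \<in> U \<Longrightarrow> v \<noteq> w \<Longrightarrow> p v \<noteq> 0 \<Longrightarrow> p w \<noteq> 0 \<Longrightarrow> order a (p v) \<noteq> order a (p w)"
  shows "(\<Sum>u\<in>U. p u) \<noteq> 0"
proof
  assume 0: "(\<Sum>u\<in>U. p u) = 0"
  define V where "V = {u\<in>U. p u \<noteq> 0}"
  have V: "finite V" "V \<noteq> {}" using assms by (auto simp: V_def)
  define v where "v = arg_min_on (\<lambda>u. order a (p u)) V"
  have v: "v \<in> V" and min: "\<And>w. w \<in> V \<Longrightarrow> order a (p v) \<le> order a (p w)"
    using arg_min_if_finite[OF V, of "\<lambda>u. order a (p u)"]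
    unfolding v_def by (auto simp: not_less)
  have "(\<Sum>u\<in>U. p u) = (\<Sum>u\<in>V. p u)"
    using assms by (intro sum.mono_neutral_right) (auto simp: V_def)
  also have "\<dots> = p v + (\<Sum>u\<in>V-{v}. p u)"
    using V v by (simp add: sum.remove)
  finally have eq: "p v = - (\<Sum>u\<in>V-{v}. p u)" using 0 by (simp add: eq_neg_iff_add_eq_0)
  have "[:-a, 1:] ^ Suc (order a (p v)) dvd p w" if "w \<in> V - {v}" for w
  proof -
    have "order a (p v) \<noteq> order a (p w)" using assms(4)[of v w] v that by (auto simp: V_def)
    hence "Suc (order a (p v)) \<le> order a (p w)" using min[of w] that by force
    thus ?thesis using order_1[of a "p w"] power_le_dvd by blast
  qed
  hence "[:-a, 1:] ^ Suc (order a (p v)) dvd p v"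
    by (subst (2) eq) (intro dvd_minus_iff[THEN iffD2] dvd_sum)
  moreover have "p v \<noteq> 0" using v by (simp add: V_def)
  ultimately show False using order_2 by blast
qed

lemma order_power:
  fixes p :: "'k::field poly"
  assumes "p \<noteq> 0" shows "order a (p ^ n) = n * order a p"
  using assms by (induction n) (simp_all add: order_mult)


text \<open>
  Stepanov's method with an auxiliary polynomial that is a \<open>P\<close>-th root: if
  \<open>G = \<Sum> x\<^sub>u t\<^bsup>kP+j\<^esup> F\<^bsup>(M-1-i)w\<^esup> c\<^bsup>i\<^esup>\<close> vanishes identically, then
  \<open>H = \<Sum> a\<^sub>u t\<^bsup>k+jP\<^esup> F\<^bsup>iw\<^esup>\<close> with \<open>a\<^sub>u\<^bsup>P\<^esup> = x\<^sub>u\<close> vanishes at every point that is counted, because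
  there \<open>H\<^bsup>P\<^esup> F\<^bsup>(M-1)w\<^esup> = G\<close>. Counting coefficients makes \<open>G = 0\<close> solvable, and the terms of
  \<open>H\<close> have distinct orders at \<open>0\<close>, so that \<open>H \<noteq> 0\<close>.
\<close>
lemma stepanov_bound:
  fixes F :: "'k::alg_closed_field poly" and c :: 'k
  assumes prime: "prime CHAR('k)" and P: "P = CHAR('k) ^ e" and Pw: "P = M * w + 1"
    and M: "M \<ge> 2" and w: "w \<ge> 1" and F: "order 0 F = 1" "F \<noteq> 0" and c: "c \<noteq> 0"
  shows "card {b. b ^ (P * P) = b \<and> poly F b ^ (w * (P + 1)) = c}
           \<le> M * w * w + (2 * M * degree F + 2) * w + degree F"
proof -
  define D where "D = degree F"
  \<comment> \<open>With this \<open>J\<close>, the unknowns indexed by \<open>U\<close> outnumber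
    the \<open>B\<close> coefficients of \<open>G\<close> by
    \<open>(M - 2) * w + (w - 1) * D + 1\<close>, which \<open>M \<ge> 2\<close> and
    \<open>w \<ge> 1\<close> keep positive.\<close>
  define J where "J = w + D"
  define U where "U = {..<M} \<times> {..<J} \<times> {..<w}"
  define B where "B = (w - 1) * P + (M - 1) * w * D + J"
  have P0: "P > 0" using Pw by simp
  have D1: "D \<ge> 1" using F order_degree[of F 0] by (simp add: D_def)
  have finU: "finite U" and cardU: "card U = M * J * w"
    by (simp_all add: U_def card_cartesian_product)
  have BU: "B < card U"
  proof -
    obtain M' where M': "M = M' + 2" using M by (metis add.commute le_Suc_ex)
    obtain w' where w': "w = w' + 1" using w by (metis add.commute le_Suc_ex)
    show ?thesis
      unfolding cardU B_def J_def Pw M' w' by (simp add: algebra_simps)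
  qed
  define g where "g = (\<lambda>(i,j,k). monom (c ^ i) (k * P + j) * F ^ ((M - 1 - i) * w))"
  obtain x where x: "\<exists>u\<in>U. x u \<noteq> 0" and xsum: "\<And>r. r < B \<Longrightarrow> (\<Sum>u\<in>U. coeff (g u) r * x u) = 0"
    using homogeneous_system_nontrivial[OF finU BU, of "\<lambda>r u. coeff (g u) r"] by blast
  have deg_g: "degree (g u) < B" if "u \<in> U" for u
  proof -
    obtain i j k where u: "u = (i,j,k)" "i < M" "j < J" "k < w" using \<open>u \<in> U\<close> by (cases u) (auto simp: U_def)
    have "degree (g u) \<le> degree (monom (c ^ i) (k * P + j)) + degree (F ^ ((M - 1 - i) * w))"
      unfolding g_def u by (simp add: degree_mult_le)
    also have "\<dots> \<le> k * P + j + (M - 1 - i) * w * D"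
      by (intro add_mono degree_monom_le order.trans[OF degree_power_le]) (simp add: D_def)
    also have "\<dots> \<le> (w - 1) * P + j + (M - 1) * w * D"
      using u by (intro add_mono mult_mono) auto
    also have "\<dots> < B" using u by (simp add: B_def)
    finally show ?thesis .
  qed
  have G0: "(\<Sum>u\<in>U. smult (x u) (g u)) = 0"
  proof (rule poly_eqI)
    fix r
    have "(\<Sum>u\<in>U. coeff (g u) r * x u) = 0"
    proof (cases "r < B")
      case False
      hence "coeff (g u) r = 0" if "u \<in> U" for u
        using deg_g[OF that] by (intro coeff_eq_0) simp
      thus ?thesis by simp
    qed (rule xsum)
    thus "coeff (\<Sum>u\<in>U. smult (x u) (g u)) r = coeff 0 r"
      by (simp add: coeff_sum mult.commute)
  qed
  obtain a where a: "\<And>u. a u ^ P = x u"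
    using nth_root_exists[OF P0, of "x _"] choice[of "\<lambda>u y. y ^ P = x u"] by blast
  define h where "h = (\<lambda>(i,j,k). monom (a (i,j,k)) (k + j * P) * F ^ (i * w))"
  define H where "H = (\<Sum>u\<in>U. h u)"
  have ord_h: "order 0 (h (i,j,k)) = k + j * P + i * w" if "h (i,j,k) \<noteq> 0" for i j k
    using that F unfolding h_def by (simp add: order_mult order_power monom_eq_0_iff)
  have "H \<noteq> 0"
  proof -
    obtain u where u: "u \<in> U" "x u \<noteq> 0" using x by blast
    have "a u \<noteq> 0" using a[of u] u P0 by (metis power_0_left less_numeral_extra(3))
    hence "h u \<noteq> 0" using F by (auto simp: h_def monom_eq_0_iff split: prod.splits)
    moreover have "v = v'" if "v \<in> U" "v' \<in> U" "h v \<noteq> 0" "h v' \<noteq> 0" "order 0 (h v) = order 0 (h v')" for v v'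
    proof -
      obtain i j k where v: "v = (i,j,k)" "i < M" "k < w" using \<open>v \<in> U\<close> by (cases v) (auto simp: U_def)
      obtain i' j' k' where v': "v' = (i',j',k')" "i' < M" "k' < w" using \<open>v' \<in> U\<close> by (cases v') (auto simp: U_def)
      \<comment> \<open>Since \<open>k + i * w < P\<close>, division by \<open>P\<close> reads off
        \<open>j\<close> from the order, and division of the remainder by \<open>w\<close> then
        reads off \<open>i\<close> and \<open>k\<close>.\<close>
      have less: "k + i * w < P" if "i < M" "k < w" for i k
      proof -
        have "i * w + w \<le> M * w" using that by (metis Suc_leI mult_Suc mult_le_mono1 add.commute)
        thus ?thesis using that Pw by linarith
      qed
      have eq: "(k + i * w) + j * P = (k' + i' * w) + j' * P"
        using that v v' by (simp add: ord_h)
      have eq2: "k + i * w = k' + i' * w" and "j = j'"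
        using arg_cong[OF eq, of "\<lambda>z. z mod P"] arg_cong[OF eq, of "\<lambda>z. z div P"] less v v' P0 by auto
      moreover have "k = k'" "i = i'"
        using arg_cong[OF eq2, of "\<lambda>z. z mod w"] arg_cong[OF eq2, of "\<lambda>z. z div w"] v v' w by auto
      ultimately show ?thesis using v v' by simp
    qed
    ultimately show ?thesis
      unfolding H_def using finU u by (intro order_sum_distinct[of U u h 0]) blast+
  qed
  have deg_H: "degree H \<le> (w - 1) + (J - 1) * P + (M - 1) * w * D"
    unfolding H_def
  proof (rule degree_sum_le[OF finU])
    fix u assume "u \<in> U"
    then obtain i j k where u: "u = (i,j,k)" "i < M" "j < J" "k < w" by (cases u) (auto simp: U_def)
    have "degree (h u) \<le> degree (monom (a u) (k + j * P)) + degree (F ^ (i * w))"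
      unfolding h_def u by (simp add: degree_mult_le)
    also have "\<dots> \<le> k + j * P + i * w * D"
      by (intro add_mono degree_monom_le order.trans[OF degree_power_le]) (simp add: D_def)
    also have "\<dots> \<le> (w - 1) + (J - 1) * P + (M - 1) * w * D"
      using u by (intro add_mono mult_mono) auto
    finally show "degree (h u) \<le> (w - 1) + (J - 1) * P + (M - 1) * w * D" .
  qed
  have root: "poly H b = 0" if b: "b ^ (P * P) = b" "poly F b ^ (w * (P + 1)) = c" for b
  proof -
    have Fb: "poly F b \<noteq> 0" using b c w by (auto simp: power_0_left)
    have "poly H b ^ P = (\<Sum>u\<in>U. poly (h u) b ^ P)"
      unfolding H_def poly_sum by (rule freshmans_dream_sum'[OF prime P])
    hence "poly H b ^ P * poly F b ^ ((M - 1) * w) = (\<Sum>u\<in>U. poly (h u) b ^ P * poly F b ^ ((M - 1) * w))"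
      by (simp add: sum_distrib_right)
    also have "\<dots> = (\<Sum>u\<in>U. poly (smult (x u) (g u)) b)"
    proof (intro sum.cong refl)
      fix u assume "u \<in> U"
      then obtain i j k where u: "u = (i,j,k)" "i < M" by (cases u) (auto simp: U_def)
      have "(M - 1) * w = i * w + (M - 1 - i) * w"
        using u by (simp flip: distrib_right)
      \<comment> \<open>The extra factor \<open>F ^ ((M - 1) * w)\<close> lends each term the
        \<open>i * w\<close> that completes \<open>F ^ (i * w * P)\<close> to the
        \<open>i\<close>-th power of \<open>F ^ (w * (P + 1))\<close>, whose value at
        \<open>b\<close> is \<open>c\<close>.\<close>
      hence e: "i * w * P + (M - 1) * w = w * (P + 1) * i + (M - 1 - i) * w"
        by (simp add: algebra_simps)
      have "poly (h u) b ^ P * poly F b ^ ((M - 1) * w)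
          = a u ^ P * (b ^ (k * P) * (b ^ (P * P)) ^ j) * poly F b ^ (i * w * P + (M - 1) * w)"
        by (simp add: h_def u poly_monom power_mult_distrib power_add flip: power_mult)
           (simp add: algebra_simps)
      also have "\<dots> = x u * b ^ (k * P + j) * (c ^ i * poly F b ^ ((M - 1 - i) * w))"
        unfolding e b(1) a b(2)[symmetric] by (simp only: power_add power_mult mult.assoc)
      also have "\<dots> = poly (smult (x u) (g u)) b"
        by (simp add: g_def u poly_monom)
      finally show "poly (h u) b ^ P * poly F b ^ ((M - 1) * w) = poly (smult (x u) (g u)) b" .
    qed
    also have "\<dots> = 0"
      unfolding poly_sum[symmetric] G0 by simp
    finally show ?thesis using Fb by simp
  qed
  have "card {b. b ^ (P * P) = b \<and> poly F b ^ (w * (P + 1)) = c} \<le> card {b. poly H b = 0}"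
    using root poly_roots_finite[OF \<open>H \<noteq> 0\<close>] by (intro card_mono) auto
  also have "\<dots> \<le> degree H" by (rule card_poly_roots_bound[OF \<open>H \<noteq> 0\<close>])
  also have "\<dots> \<le> (w - 1) + (J - 1) * P + (M - 1) * w * D" by (rule deg_H)
  also have "\<dots> \<le> w + J * P + M * w * D"
    by (intro add_mono mult_mono) auto
  also have "\<dots> = M * w * w + (2 * M * D + 2) * w + D"
    unfolding J_def Pw by (simp add: algebra_simps)
  finally show ?thesis unfolding D_def .
qed

section \<open>Primary polynomials and Newton's identity\<close>

definition monics :: "nat \<Rightarrow> 'a::field poly set" where
  "monics d = {g. lead_coeff g = 1 \<and> degree g = d}"

lemma monics_0: "monics 0 = {1 :: 'a::field poly}"
  using monic_degree_0 by (auto simp: monics_def)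

lemma monics_Suc: "monics (Suc d) = (\<lambda>(a, p). pCons a p) ` (UNIV \<times> (monics d :: 'a::field poly set))"
proof (intro equalityI subsetI)
  fix g :: "'a poly" assume "g \<in> monics (Suc d)"
  thus "g \<in> (\<lambda>(a, p). pCons a p) ` (UNIV \<times> monics d)"
    by (cases g rule: pCons_cases) (auto simp: monics_def split: if_splits)
qed (auto simp: monics_def)

lemma finite_monics [simp, intro]: "finite (monics d :: 'a::{field,finite} poly set)"
  by (induction d) (auto simp: monics_0 monics_Suc)

lemma card_monics: "card (monics d :: 'a::{field,finite} poly set) = CARD('a) ^ d"
proof (induction d)
  case (Suc d)
  have "inj_on (\<lambda>(a, p). pCons a p) (UNIV \<times> (monics d :: 'a poly set))"
    by (auto simp: inj_on_def)
  thus ?case by (simp add: monics_Suc card_image card_cartesian_product Suc)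
qed (simp add: monics_0)

lemma irreducible_smult_field:
  fixes p :: "'a::field poly"
  assumes "irreducible p" "c \<noteq> 0" shows "irreducible (smult c p)"
proof -
  have "is_unit [:c:]" using assms by simp
  thus ?thesis using assms irreducible_mult_unit_left[of "[:c:]" p] by simp
qed

lemma degree_irreducible_pos: "irreducible p \<Longrightarrow> degree (p :: 'a::field poly) > 0"
  by (metis gr0I irreducible_def is_unit_iff_degree)

lemma monic_irreducible_dvd_irreducible:
  fixes p r :: "'a::field poly"
  assumes "irreducible p" "irreducible r" "lead_coeff p = 1" "lead_coeff r = 1" "p dvd r"
  shows "p = r"
  using assms poly_dvd_antisym[of p r] irreducibleD'[of r p] irreducible_not_unit[of p] by auto

lemma exists_monic_irreducible_factor:
  fixes g :: "'a::field poly"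
  assumes "degree g > 0"
  obtains p where "irreducible p" "lead_coeff p = 1" "p dvd g"
proof -
  define p where "p = arg_min degree (\<lambda>p. degree p > 0 \<and> p dvd g)"
  have p: "degree p > 0" "p dvd g" and min: "\<And>r. degree r > 0 \<Longrightarrow> r dvd g \<Longrightarrow> degree p \<le> degree r"
    using arg_min_nat_lemma[of "\<lambda>p. degree p > 0 \<and> p dvd g" g degree] assms
    unfolding p_def by auto
  have p0: "p \<noteq> 0" using p by auto
  have "irreducible p"
  proof (rule irreducibleI)
    show "\<not> is_unit p" using p by (simp add: is_unit_iff_degree p0)
    fix a b assume ab: "p = a * b"
    hence nz: "a \<noteq> 0" "b \<noteq> 0" using p0 by auto
    hence "degree p = degree a + degree b" using ab by (simp add: degree_mult_eq)
    moreover have "a dvd g" "b dvd g"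
      using p(2) ab dvd_mult_left dvd_mult_right by blast+
    hence "degree a > 0 \<Longrightarrow> degree p \<le> degree a" "degree b > 0 \<Longrightarrow> degree p \<le> degree b"
      using min by blast+
    ultimately have "degree a = 0 \<or> degree b = 0" by linarith
    thus "is_unit a \<or> is_unit b" using nz by (auto simp: is_unit_iff_degree)
  qed (rule p0)
  hence "irreducible (smult (inverse (lead_coeff p)) p)" using p0 by (intro irreducible_smult_field) auto
  moreover have "lead_coeff (smult (inverse (lead_coeff p)) p) = 1" using p0 by simp
  moreover have "smult (inverse (lead_coeff p)) p dvd g"
    using p p0 by (simp add: smult_dvd_iff)
  ultimately show ?thesis using that by blast
qed

text \<open>The base in \<open>primary_poly\<close> need not be monic, but the \<open>k\<close>-th
  power of its leading coefficient is 1 because \<open>g\<close> is monic, so normalising the base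
  does not change \<open>g\<close>.\<close>

lemma primary_polysE:
  fixes g :: "'a::field poly"
  assumes "g \<in> primary_polys d"
  obtains p k where "irreducible p" "lead_coeff p = 1" "k \<ge> 1" "g = p ^ k" "d = k * degree p" "d > 0"
proof -
  from assms obtain p k where p: "irreducible p" "g = p ^ k" and g: "lead_coeff g = 1" "degree g = d" "d > 0"
    by (auto simp: primary_polys_def primary_poly_def)
  have k: "k \<ge> 1" using p g by (cases k) auto
  have p0: "p \<noteq> 0" using p by auto
  define r where "r = smult (inverse (lead_coeff p)) p"
  have "r ^ k = smult (inverse (lead_coeff p ^ k)) g"
    by (simp add: r_def p smult_power power_inverse)
  also have "lead_coeff p ^ k = 1" using g p by (simp add: lead_coeff_power)
  finally have "g = r ^ k" by simp
  moreover have "irreducible r" unfolding r_def using p p0 by (intro irreducible_smult_field) auto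
  moreover have "lead_coeff r = 1" using p0 by (simp add: r_def)
  moreover have "d = k * degree r"
    using \<open>g = r ^ k\<close> g(2) \<open>irreducible r\<close> by (auto simp: degree_power_eq)
  ultimately show ?thesis using that k g by blast
qed

lemma primary_polysI:
  fixes p :: "'a::field poly"
  assumes "irreducible p" "lead_coeff p = 1" "k \<ge> 1" "d = k * degree p"
  shows "p ^ k \<in> primary_polys d"
proof -
  have "p \<noteq> 0" using assms by auto
  hence "degree (p ^ k) = d" using assms by (simp add: degree_power_eq)
  moreover have "lead_coeff (p ^ k) = 1" using assms by (simp add: lead_coeff_power)
  moreover have "d > 0" using assms degree_irreducible_pos[of p] by simp
  ultimately show ?thesis using assms(1) by (auto simp: primary_polys_def primary_poly_def)
qed

lemma primary_polys_subset_monics: "primary_polys d \<subseteq> monics d"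
  by (auto simp: primary_polys_def monics_def)

lemma finite_primary_polys [simp, intro]: "finite (primary_polys d :: 'a::{field,finite} poly set)"
  by (rule finite_subset[OF primary_polys_subset_monics]) simp

lemma primary_polys_0 [simp]: "primary_polys 0 = {}"
  by (auto simp: primary_polys_def primary_poly_def)

text \<open>The von Mangoldt weight: \<open>base_degree (p\<^bsup>k\<^esup>) = degree p\<close> for irreducible \<open>p\<close> and \<open>k \<ge> 1\<close>.\<close>

definition base_degree :: "'a::field poly \<Rightarrow> nat" where
  "base_degree g = (SOME m. \<exists>p k. irreducible p \<and> k \<ge> 1 \<and> g = p ^ k \<and> m = degree p)"

text \<open>Two irreducible bases of the same power divide each other, so the choice made in
  \<open>base_degree\<close> does not matter.\<close>

lemma base_degree_power:
  fixes p :: "'a::field poly"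
  assumes "irreducible p" "k \<ge> 1"
  shows "base_degree (p ^ k) = degree p"
proof -
  have "\<exists>r j. irreducible r \<and> j \<ge> 1 \<and> p ^ k = r ^ j \<and> base_degree (p ^ k) = degree r"
    unfolding base_degree_def by (rule someI_ex) (use assms in blast)
  then obtain r j where r: "irreducible r" "j \<ge> 1" "p ^ k = r ^ j" "base_degree (p ^ k) = degree r"
    by blast
  have "p dvd r ^ j" "r dvd p ^ k"
    using r(2,3) assms(2) by (metis dvd_power One_nat_def Suc_le_lessD)+
  hence "p dvd r" "r dvd p"
    using field_poly_irreducible_imp_prime assms(1) r(1) prime_elem_dvd_power by blast+
  moreover have "p \<noteq> 0" "r \<noteq> 0" using assms r by auto
  ultimately show ?thesis using r(4) dvd_imp_degree_le le_antisym by metis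
qed

lemma base_degree_le: "g \<in> primary_polys d \<Longrightarrow> base_degree g \<le> d"
  by (elim primary_polysE) (simp add: base_degree_power)

text \<open>The analogue of log m being the sum of the von Mangoldt function over the divisors of m.
  Splitting off one irreducible factor, \<open>g = p * s\<close>, adds the single primary divisor
  \<open>p ^ Suc v\<close>, where \<open>v\<close> is the multiplicity of \<open>p\<close> in
  \<open>s\<close>, and it contributes \<open>degree p\<close>.\<close>

lemma sum_base_degree_primary_divisors:
  fixes g :: "'a::{field,finite} poly"
  assumes "lead_coeff g = 1"
  shows "finite {h. lead_coeff h = 1 \<and> primary_poly h \<and> h dvd g}"
    and "(\<Sum>h | lead_coeff h = 1 \<and> primary_poly h \<and> h dvd g. base_degree h) = degree g"
proof -
  define D where "D = (\<lambda>g::'a poly. {h. lead_coeff h = 1 \<and> primary_poly h \<and> h dvd g})"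
  have "finite (D g) \<and> (\<Sum>h\<in>D g. base_degree h) = degree g"
    using assms
  proof (induction "degree g" arbitrary: g rule: less_induct)
    case (less g)
    have g0: "g \<noteq> 0" using less.prems by auto
    show ?case
    proof (cases "degree g = 0")
      case True
      hence "g = 1" using less.prems by (simp add: monic_degree_0)
      hence "D g = {}"
        by (auto simp: D_def primary_poly_def is_unit_iff_degree poly_dvd_1)
      thus ?thesis using True by simp
    next
      case False
      then obtain p where p: "irreducible p" "lead_coeff p = 1" "p dvd g"
        using exists_monic_irreducible_factor by blast
      then obtain s where g: "g = p * s" by (elim dvdE)
      have p0: "p \<noteq> 0" using p(1) by auto
      have s: "lead_coeff s = 1" "s \<noteq> 0" using less.prems p g by (auto simp: lead_coeff_mult)
      have deg: "degree g = degree p + degree s" using g g0 by (simp add: degree_mult_eq)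
      have IH: "finite (D s)" "(\<Sum>h\<in>D s. base_degree h) = degree s"
        using less.hyps[of s] s deg degree_irreducible_pos[OF p(1)] by auto
      have "\<exists>v. p ^ v dvd s \<and> (\<forall>j. p ^ j dvd s \<longrightarrow> j \<le> v)"
      proof (rule Nat.ex_has_greatest_nat[where b = "degree s"])
        show "p ^ 0 dvd s" by simp
        show "\<forall>j. p ^ j dvd s \<longrightarrow> j \<le> degree s"
        proof (intro allI impI)
          fix j assume "p ^ j dvd s"
          hence "j * degree p \<le> degree s"
            using s p0 dvd_imp_degree_le[of "p ^ j" s] by (simp add: degree_power_eq mult.commute)
          thus "j \<le> degree s" using degree_irreducible_pos[OF p(1)]
            by (metis le_trans less_eq_Suc_le mult_le_mono2 nat_mult_1_right One_nat_def)
        qed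
      qed
      then obtain v where v: "p ^ v dvd s" "\<And>j. p ^ j dvd s \<Longrightarrow> j \<le> v" by blast
      have "p ^ Suc v \<in> primary_polys (Suc v * degree p)"
        using p by (intro primary_polysI) auto
      hence "lead_coeff (p ^ Suc v) = 1" "primary_poly (p ^ Suc v)"
        unfolding primary_polys_def by blast+
      moreover have "p ^ Suc v dvd g" using v(1) by (simp add: g mult_dvd_mono)
      ultimately have new: "p ^ Suc v \<in> D g"
        unfolding D_def by blast
      have notin: "p ^ Suc v \<notin> D s" using v(2)[of "Suc v"] by (auto simp: D_def simp del: power_Suc)
      have "D g = insert (p ^ Suc v) (D s)"
      proof (intro equalityI subsetI)
        fix h assume h: "h \<in> D g"
        hence "h \<in> primary_polys (degree h)" by (auto simp: D_def primary_polys_def)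
        then obtain r k where r: "irreducible r" "lead_coeff r = 1" "k \<ge> 1" "h = r ^ k"
          by (elim primary_polysE)
        have dvd: "r ^ k dvd p * s" using h r g by (simp add: D_def)
        show "h \<in> insert (p ^ Suc v) (D s)"
        proof (cases "r = p")
          case True
          hence "p * p ^ (k - 1) dvd p * s" using dvd r(3) by (metis power_Suc Suc_diff_1 One_nat_def Suc_le_lessD)
          hence "p ^ (k - 1) dvd s" using p(1) by auto
          hence "k - 1 \<le> v" by (rule v(2))
          hence "k = Suc v \<or> k \<le> v" using r(3) by linarith
          moreover have "p ^ k dvd s" if "k \<le> v" using that v(1) power_le_dvd by blast
          ultimately show ?thesis using h True r by (auto simp: D_def)
        next
          case False
          have "\<not> r dvd p" using False monic_irreducible_dvd_irreducible[of r p] r p by blast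
          obtain a b where ab: "a + b = k" "r ^ a dvd p" "r ^ b dvd s"
            using prime_elem_power_dvd_prod[OF dvd field_poly_irreducible_imp_prime[OF r(1)]] by blast
          have "a = 0"
          proof (rule ccontr)
            assume "a \<noteq> 0"
            hence "r dvd r ^ a" by (simp add: dvd_power)
            thus False using ab(2) \<open>\<not> r dvd p\<close> dvd_trans by blast
          qed
          thus ?thesis using ab h r by (auto simp: D_def)
        qed
      next
        fix h assume "h \<in> insert (p ^ Suc v) (D s)"
        thus "h \<in> D g" using new by (auto simp: D_def g)
      qed
      thus ?thesis using IH notin base_degree_power[OF p(1), of "Suc v"] deg
        by (simp del: power_Suc)
    qed
  qed
  thus "finite {h. lead_coeff h = 1 \<and> primary_poly h \<and> h dvd g}"
    and "(\<Sum>h | lead_coeff h = 1 \<and> primary_poly h \<and> h dvd g. base_degree h) = degree g"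
    by (simp_all add: D_def)
qed

text \<open>The weighted sums over primary polynomials are the coefficients of \<open>u L'/L\<close>.\<close>

lemma newton_identity_primary_sums:
  fixes \<psi> :: "'a::{field,finite} poly \<Rightarrow> 'c::comm_ring_1"
  assumes mult: "\<And>g h. \<psi> (g * h) = \<psi> g * \<psi> h"
  shows "of_nat d * (\<Sum>g\<in>monics d. \<psi> g)
    = (\<Sum>i=1..d. (\<Sum>h\<in>primary_polys i. of_nat (base_degree h) * \<psi> h) * (\<Sum>g\<in>monics (d - i). \<psi> g))"
proof -
  define D where "D = (\<lambda>g::'a poly. {h. lead_coeff h = 1 \<and> primary_poly h \<and> h dvd g})"
  have finD: "finite (D g)" if "g \<in> monics d" for g
    using that sum_base_degree_primary_divisors(1) by (auto simp: D_def monics_def)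
  \<comment> \<open>Here \<open>d\<close> is replaced by the total weight of the primary divisors of
    \<open>g\<close>; the pairs with \<open>h dvd g\<close> are then regrouped by \<open>h\<close>
    and the cofactor \<open>g div h\<close>.\<close>
  have "of_nat d * (\<Sum>g\<in>monics d. \<psi> g) = (\<Sum>g\<in>monics d. \<Sum>h\<in>D g. of_nat (base_degree h) * \<psi> g)"
    unfolding sum_distrib_left
  proof (intro sum.cong refl)
    fix g :: "'a poly" assume "g \<in> monics d"
    hence "lead_coeff g = 1" "degree g = d" by (auto simp: monics_def)
    hence "d = (\<Sum>h\<in>D g. base_degree h)"
      using sum_base_degree_primary_divisors(2)[of g] by (simp add: D_def)
    thus "of_nat d * \<psi> g = (\<Sum>h\<in>D g. of_nat (base_degree h) * \<psi> g)"
      by (simp flip: sum_distrib_right of_nat_sum)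
  qed
  also have "\<dots> = (\<Sum>(g, h)\<in>(SIGMA g:monics d. D g). of_nat (base_degree h) * \<psi> g)"
    using finD by (intro sum.Sigma) auto
  also have "\<dots> = (\<Sum>(i, h, g)\<in>(SIGMA i:{1..d}. primary_polys i \<times> monics (d - i)). of_nat (base_degree h) * \<psi> h * \<psi> g)"
  proof (rule sum.reindex_bij_witness[of _ "\<lambda>(i, h, g). (h * g, h)" "\<lambda>(g, h). (degree h, h, g div h)"])
    fix z assume "z \<in> (SIGMA g:monics d. D g)"
    then obtain g h s where z: "z = (g, h)" "g = h * s" "lead_coeff g = 1" "degree g = d"
        "lead_coeff h = 1" "primary_poly h"
      by (auto simp: monics_def D_def elim!: dvdE)
    have nz: "h \<noteq> 0" "s \<noteq> 0" using z by auto
    have s: "lead_coeff s = 1" using z by (simp add: lead_coeff_mult)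
    have deg: "d = degree h + degree s" using z nz by (auto simp: degree_mult_eq)
    have h: "degree h > 0" using z by (simp add: primary_poly_def)
    show "(case (case z of (g, h) \<Rightarrow> (degree h, h, g div h)) of (i, h, g) \<Rightarrow> (h * g, h)) = z"
      using z nz by simp
    show "(case z of (g, h) \<Rightarrow> (degree h, h, g div h)) \<in> (SIGMA i:{1..d}. primary_polys i \<times> monics (d - i))"
      using z nz s deg h by (auto simp: monics_def primary_polys_def)
    show "(case (case z of (g, h) \<Rightarrow> (degree h, h, g div h)) of (i, h, g) \<Rightarrow> of_nat (base_degree h) * \<psi> h * \<psi> g)
        = (case z of (g, h) \<Rightarrow> of_nat (base_degree h) * \<psi> g)"
      using z nz by (simp add: mult mult.assoc)
  next
    fix z assume "z \<in> (SIGMA i:{1..d}. (primary_polys i :: 'a poly set) \<times> (monics (d - i) :: 'a poly set))"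
    then obtain i h g where z: "z = (i, h, g)" "i \<ge> 1" "i \<le> d" "lead_coeff h = 1" "degree h = i" "primary_poly h"
        "lead_coeff g = 1" "degree g = d - i"
      by (auto simp: monics_def primary_polys_def)
    have nz: "h \<noteq> 0" "g \<noteq> 0" using z by auto
    show "(case (case z of (i, h, g) \<Rightarrow> (h * g, h)) of (g, h) \<Rightarrow> (degree h, h, g div h)) = z"
      using z nz by simp
    have "lead_coeff (h * g) = 1"
      using z(4,7) by (simp only: lead_coeff_mult mult_1)
    moreover have "degree (h * g) = d"
      using z nz by (simp add: degree_mult_eq)
    ultimately show "(case z of (i, h, g) \<Rightarrow> (h * g, h)) \<in> (SIGMA g:monics d. D g)"
      using z by (auto simp: monics_def D_def)
  qed
  also have "\<dots> = (\<Sum>i=1..d. \<Sum>(h, g)\<in>primary_polys i \<times> monics (d - i). of_nat (base_degree h) * \<psi> h * \<psi> g)"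
    by (rule sum.Sigma[symmetric]) auto
  also have "\<dots> = (\<Sum>i=1..d. (\<Sum>h\<in>primary_polys i. of_nat (base_degree h) * \<psi> h) * (\<Sum>g\<in>monics (d - i). \<psi> g))"
    by (simp add: sum_product sum.cartesian_product)
  finally show ?thesis .
qed

text \<open>Newton's identity for the constant function 1, whose sums over \<open>monics\<close> are
  powers of \<open>q\<close>: by induction each \<open>i < d\<close> contributes exactly
  \<open>q ^ d\<close>, and one such term is left for \<open>i = d\<close>.\<close>

lemma sum_base_degree_primary_polys:
  assumes "d \<ge> 1"
  shows "(\<Sum>h\<in>(primary_polys d :: 'a::{field,finite} poly set). base_degree h) = CARD('a) ^ d"
  using assms
proof (induction d rule: less_induct)
  case (less d)
  define q where "q = CARD('a)"
  define T where "T = (\<lambda>i. \<Sum>h\<in>(primary_polys i :: 'a poly set). base_degree h)"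
  have "int d * int q ^ d = (\<Sum>i=1..d. int (T i) * int q ^ (d - i))"
    using newton_identity_primary_sums[of "\<lambda>_::'a poly. 1 :: int" d]
    by (simp add: card_monics q_def T_def)
  also have "\<dots> = (\<Sum>i\<in>{1..<d}. int (T i) * int q ^ (d - i)) + int (T d)"
    using less.prems by (simp add: sum.last_plus)
  also have "(\<Sum>i\<in>{1..<d}. int (T i) * int q ^ (d - i)) = (\<Sum>i\<in>{1..<d}. int q ^ d)"
    using less.IH by (intro sum.cong) (simp_all add: T_def q_def flip: power_add)
  also have "\<dots> = (int d - 1) * int q ^ d"
    using less.prems by (simp add: of_nat_diff)
  finally have "int (T d) = int (q ^ d)" by (simp add: algebra_simps)
  thus ?case unfolding T_def q_def by linarith
qed

section \<open>Finite fields inside the algebraic closure\<close>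

lemma prime_CHAR_finite_field: "prime CHAR('a::{field,finite})"
  using prime_CHAR_semidom[where 'a = 'a] finite_imp_CHAR_pos[where 'a = 'a] by simp

text \<open>Sylow's theorem provides an additive subgroup of order \<open>r\<close>. Translation by
  one of its nonzero elements \<open>x\<close> permutes it, and comparing the two sums over it gives
  \<open>of_nat r * x = 0\<close>.\<close>

lemma prime_dvd_CARD_field:
  assumes "prime r" "r dvd CARD('a::{field,finite})"
  shows "r = CHAR('a)"
proof -
  define G :: "'a monoid" where "G = \<lparr>carrier = UNIV, monoid.mult = (+), one = 0\<rparr>"
  have "group G"
    by (rule groupI) (auto simp: G_def add.assoc intro: exI[of _ "- _"] ab_left_minus)
  moreover have "Coset.order G = r ^ 1 * (CARD('a) div r)"
    using assms by (simp add: Coset.order_def G_def)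
  ultimately obtain H where H: "subgroup H G" "card H = r"
    using sylow_thm[of r G 1 "CARD('a) div r"] assms(1) by (auto simp: G_def)
  have r2: "r \<ge> 2" using assms(1) by (rule prime_ge_2_nat)
  obtain x where x: "x \<in> H" "x \<noteq> 0"
  proof -
    have "\<not> H \<subseteq> {0}" using H(2) r2 card_mono[of "{0}" H] by fastforce
    thus ?thesis using that by blast
  qed
  have "(\<lambda>y. x + y) ` H \<subseteq> H"
    using subgroup.m_closed[OF H(1), of x] x by (auto simp: G_def)
  hence "(\<lambda>y. x + y) ` H = H"
    by (intro card_subset_eq) (auto simp: card_image)
  hence "(\<Sum>y\<in>H. y) = (\<Sum>y\<in>H. x + y)"
    by (metis (no_types, lifting) sum.reindex_cong add_left_imp_eq inj_onI)
  hence "of_nat r * x = 0" by (simp add: sum.distrib H(2))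
  hence "CHAR('a) dvd r" using x by (simp add: of_nat_eq_0_iff_char_dvd)
  thus ?thesis using assms(1) prime_CHAR_finite_field[where 'a = 'a] primes_dvd_imp_eq by blast
qed

text \<open>No prime other than the characteristic can divide the order. This makes raising to the
  power \<open>CARD('a)\<close> an iterate of Frobenius and hence additive.\<close>

lemma CARD_field_eq_CHAR_power:
  obtains e where "CARD('a::{field,finite}) = CHAR('a) ^ e"
proof -
  define p where "p = CHAR('a)"
  have p: "prime p" unfolding p_def by (rule prime_CHAR_finite_field)
  have "CARD('a) \<noteq> 0" by simp
  obtain m where m: "CARD('a) = p ^ multiplicity p CARD('a) * m" "\<not> p dvd m"
  proof (rule multiplicity_decompose'[of "CARD('a)" p])
    show "\<not> is_unit p" using p by auto
  qed auto
  have "m = 1"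
  proof (rule ccontr)
    assume "m \<noteq> 1"
    then obtain r where r: "prime r" "r dvd m" using prime_factor_nat by blast
    hence "r dvd CARD('a)" using m(1) by (metis dvd_mult)
    thus False using prime_dvd_CARD_field[OF r(1), where 'a = 'a] r m(2) by (simp add: p_def)
  qed
  thus ?thesis using that m(1) by (simp add: p_def)
qed

lemma CARD_field_ge_2: "CARD('a::{field,finite}) \<ge> 2"
proof -
  have "card {0, 1 :: 'a} \<le> CARD('a)" by (intro card_mono) auto
  thus ?thesis by simp
qed

section \<open>Evaluation of polynomials at an element of an extension field\<close>

context
  fixes \<iota> :: "'a::field \<Rightarrow> 'b::field"
  assumes hom: "field_hom \<iota>"
begin

interpretation field_hom \<iota> by (rule hom)
interpretation mp: map_poly_comm_ring_hom \<iota> ..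
interpretation mi: map_poly_inj_comm_ring_hom \<iota> ..

lemma eval_at_mult: "eval_at \<iota> x (g * h) = eval_at \<iota> x g * eval_at \<iota> x h"
  by (simp add: eval_at_def mp.hom_mult)

lemma eval_at_add: "eval_at \<iota> x (g + h) = eval_at \<iota> x g + eval_at \<iota> x h"
  by (simp add: eval_at_def mp.hom_add)

lemma eval_at_diff: "eval_at \<iota> x (g - h) = eval_at \<iota> x g - eval_at \<iota> x h"
  by (simp add: eval_at_def hom_distribs)

lemma eval_at_power: "eval_at \<iota> x (g ^ k) = eval_at \<iota> x g ^ k"
  by (simp add: eval_at_def hom_distribs)

lemma eval_at_0 [simp]: "eval_at \<iota> x 0 = 0"
  by (simp add: eval_at_def)

lemma eval_at_1 [simp]: "eval_at \<iota> x 1 = 1"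
  by (simp add: eval_at_def)

lemma eval_at_monom: "eval_at \<iota> x (monom c k) = \<iota> c * x ^ k"
  by (simp add: eval_at_def map_poly_monom poly_monom)

lemma eval_at_mod:
  assumes "eval_at \<iota> x f = 0"
  shows "eval_at \<iota> x (g mod f) = eval_at \<iota> x g"
proof -
  have "eval_at \<iota> x g = eval_at \<iota> x (g div f * f + g mod f)" by simp
  also have "\<dots> = eval_at \<iota> x (g mod f)"
    unfolding eval_at_add eval_at_mult assms by simp
  finally show ?thesis ..
qed

lemma map_poly_field_hom_inj: "map_poly \<iota> g = map_poly \<iota> h \<Longrightarrow> g = h"
  by simp

lemma inj_on_eval_at:
  assumes "irreducible f" "eval_at \<iota> x f = 0"
  shows "inj_on (eval_at \<iota> x) {g. degree g < degree f}"
proof (rule inj_onI)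
  fix g h assume *: "g \<in> {g. degree g < degree f}" "h \<in> {g. degree g < degree f}" "eval_at \<iota> x g = eval_at \<iota> x h"
  have "degree (g - h) < degree f" using * degree_diff_less by auto
  thus "g = h"
    using no_small_annihilator[OF hom assms, of "g - h"] * by (force simp: eval_at_diff)
qed

text \<open>Applied to two extensions, this transfers congruences modulo \<open>f\<close> between
  \<open>\<alpha>\<close> in the type \<open>'b\<close> and a root of \<open>f\<close> in the
  algebraic closure, without an embedding of one field in the other.\<close>

lemma eval_at_eq_0_iff_dvd:
  assumes "irreducible f" "eval_at \<iota> x f = 0"
  shows "eval_at \<iota> x g = 0 \<longleftrightarrow> f dvd g"
proof
  assume "eval_at \<iota> x g = 0"
  hence "eval_at \<iota> x (g mod f) = 0" using assms by (simp add: eval_at_mod)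
  moreover have "f \<noteq> 0" using assms by auto
  ultimately have "g mod f = 0"
    using no_small_annihilator[OF hom assms, of "g mod f"] degree_mod_less[of f g] by force
  thus "f dvd g" by auto
qed (auto simp: assms eval_at_mult elim!: dvdE)

end

lemma card_degree_less:
  assumes "m \<ge> 1"
  shows "finite {g :: 'a::{field,finite} poly. degree g < m}"
    and "card {g :: 'a::{field,finite} poly. degree g < m} = CARD('a) ^ m"
proof -
  have *: "{g :: 'a poly. degree g < m} = (\<lambda>h. h - monom 1 m) ` monics m"
  proof (intro equalityI subsetI)
    fix g :: "'a poly" assume "g \<in> {g. degree g < m}"
    hence g: "degree g < m" by simp
    have "degree (monom 1 m + g) = m" using g by (simp add: degree_add_eq_left degree_monom_eq)
    moreover have "coeff (monom 1 m + g) m = 1" using g by (simp add: coeff_eq_0)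
    ultimately have "monom 1 m + g \<in> monics m" by (simp add: monics_def)
    thus "g \<in> (\<lambda>h. h - monom 1 m) ` monics m" by (auto intro!: image_eqI[of _ _ "monom 1 m + g"])
  next
    fix g :: "'a poly" assume "g \<in> (\<lambda>h. h - monom 1 m) ` monics m"
    then obtain h :: "'a poly" where h: "h \<in> monics m" "g = h - monom 1 m" by blast
    have "degree g < m"
      unfolding h(2) using h(1) assms
      by (intro degree_lessI) (auto simp: monics_def coeff_eq_0)
    thus "g \<in> {g. degree g < m}" by simp
  qed
  have inj: "inj_on (\<lambda>h. h - monom 1 m) (monics m :: 'a poly set)" by (auto simp: inj_on_def)
  show "finite {g :: 'a poly. degree g < m}" unfolding * by simp
  show "card {g :: 'a poly. degree g < m} = CARD('a) ^ m"
    unfolding * by (simp add: card_image[OF inj] card_monics)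
qed

section \<open>The algebraic closure and its Frobenius powers\<close>

lemma field_hom_to_ac: "field_hom (to_ac :: 'a::field \<Rightarrow> 'a alg_closure)"
  by unfold_locales auto

abbreviation ev :: "'a::field alg_closure \<Rightarrow> 'a poly \<Rightarrow> 'a alg_closure" where
  "ev \<equiv> eval_at to_ac"

lemmas ev_simps = eval_at_mult[OF field_hom_to_ac] eval_at_add[OF field_hom_to_ac]
  eval_at_diff[OF field_hom_to_ac] eval_at_power[OF field_hom_to_ac] eval_at_monom[OF field_hom_to_ac]
  eval_at_0[OF field_hom_to_ac] eval_at_1[OF field_hom_to_ac]

lemma CARD_power_eq_CHAR_power:
  obtains e where "CARD('a::{field,finite}) ^ i = CHAR('a alg_closure) ^ e"
  using CARD_field_eq_CHAR_power[where 'a = 'a] by (metis CHAR_alg_closure power_mult)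

lemma prime_CHAR_alg_closure: "prime CHAR('a::{field,finite} alg_closure)"
  by (simp add: prime_CHAR_finite_field)

lemma frobenius_sum:
  fixes h :: "'u \<Rightarrow> 'a::{field,finite} alg_closure"
  shows "(\<Sum>u\<in>U. h u) ^ (CARD('a) ^ i) = (\<Sum>u\<in>U. h u ^ (CARD('a) ^ i))"
  by (metis CARD_power_eq_CHAR_power freshmans_dream_sum' prime_CHAR_alg_closure)

lemma frobenius_diff:
  fixes x y :: "'a::{field,finite} alg_closure"
  shows "(x - y) ^ (CARD('a) ^ i) = x ^ (CARD('a) ^ i) - y ^ (CARD('a) ^ i)"
proof -
  obtain e where e: "CARD('a) ^ i = CHAR('a alg_closure) ^ e" by (rule CARD_power_eq_CHAR_power)
  have "(x - y + y) ^ (CARD('a) ^ i) = (x - y) ^ (CARD('a) ^ i) + y ^ (CARD('a) ^ i)"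
    by (rule freshmans_dream'[OF prime_CHAR_alg_closure e])
  thus ?thesis by (simp add: algebra_simps)
qed

lemma frobenius_inj:
  fixes x y :: "'a::{field,finite} alg_closure"
  assumes "x ^ (CARD('a) ^ i) = y ^ (CARD('a) ^ i)"
  shows "x = y"
  using frobenius_diff[of x y i] assms by simp

lemma power_CARD_field: "c ^ CARD('a) = (c :: 'a::{field,finite})"
proof (cases "c = 0")
  case False
  have "(\<Prod>y\<in>UNIV-{0}. c * y) = (\<Prod>y\<in>UNIV-{0}. y)"
    by (rule prod.reindex_bij_witness[of _ "\<lambda>y. y / c" "\<lambda>y. c * y"]) (use False in auto)
  hence "c ^ (CARD('a) - 1) = 1" by (simp add: prod.distrib)
  hence "c * c ^ (CARD('a) - 1) = c" by simp
  thus ?thesis by (simp flip: power_Suc)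
qed (simp add: power_0_left)

lemma to_ac_power_CARD: "to_ac (c :: 'a::{field,finite}) ^ (CARD('a) ^ i) = to_ac c"
proof -
  have "c ^ (CARD('a) ^ i) = c"
    by (induction i) (simp_all add: power_mult power_CARD_field)
  thus ?thesis by (metis to_ac_power)
qed

lemma ev_frobenius:
  fixes x :: "'a::{field,finite} alg_closure"
  shows "ev (x ^ (CARD('a) ^ i)) g = ev x g ^ (CARD('a) ^ i)"
proof -
  have deg: "degree (map_poly to_ac g) = degree g" by (rule degree_map_poly) simp
  have "ev x g ^ (CARD('a) ^ i) = (\<Sum>j\<le>degree g. (to_ac (coeff g j) * x ^ j) ^ (CARD('a) ^ i))"
    unfolding eval_at_def poly_altdef deg by (simp add: frobenius_sum coeff_map_poly)
  also have "\<dots> = (\<Sum>j\<le>degree g. to_ac (coeff g j) * (x ^ (CARD('a) ^ i)) ^ j)"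
    by (simp add: power_mult_distrib to_ac_power_CARD flip: power_mult) (simp add: mult.commute)
  also have "\<dots> = ev (x ^ (CARD('a) ^ i)) g"
    unfolding eval_at_def poly_altdef deg by (simp add: coeff_map_poly)
  finally show ?thesis ..
qed

text \<open>For \<open>i \<ge> 1\<close> this is the subfield with \<open>CARD('a) ^ i\<close>
  elements of the algebraic closure; that the cardinality is attained follows later from the
  weighted count of primary polynomials.\<close>

definition fixed_points :: "nat \<Rightarrow> 'a::{field,finite} alg_closure set" where
  "fixed_points i = {x. x ^ (CARD('a) ^ i) = x}"

lemma fixed_points_roots:
  "fixed_points i = {x :: 'a::{field,finite} alg_closure. poly (monom 1 (CARD('a) ^ i) - monom 1 1) x = 0}"
  by (auto simp: fixed_points_def poly_monom)

lemma degree_frobenius_poly: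
  assumes "i \<ge> 1"
  shows "degree (monom 1 (CARD('a::{field,finite}) ^ i) - monom 1 1 :: 'c::field poly) = CARD('a) ^ i"
proof -
  have "1 < CARD('a) ^ i" using CARD_field_ge_2[where 'a = 'a] assms by (intro one_less_power) auto
  thus ?thesis
    using degree_add_eq_left[of "- monom 1 1" "monom 1 (CARD('a) ^ i) :: 'c poly"]
    by (simp add: degree_monom_eq)
qed

lemma
  assumes "i \<ge> 1"
  shows finite_fixed_points: "finite (fixed_points i :: 'a::{field,finite} alg_closure set)"
    and card_fixed_points_le: "card (fixed_points i :: 'a alg_closure set) \<le> CARD('a) ^ i"
proof -
  have "CARD('a) ^ i \<noteq> 0" by simp
  hence "(monom 1 (CARD('a) ^ i) - monom 1 1 :: 'a alg_closure poly) \<noteq> 0"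
    using degree_frobenius_poly[OF assms, where 'a = 'a and 'c = "'a alg_closure"] by fastforce
  from poly_roots_finite[OF this] card_poly_roots_bound[OF this] show
    "finite (fixed_points i :: 'a alg_closure set)" "card (fixed_points i :: 'a alg_closure set) \<le> CARD('a) ^ i"
    unfolding fixed_points_roots degree_frobenius_poly[OF assms] by auto
qed

section \<open>Conjugates of a root of an irreducible polynomial\<close>

context
  fixes f :: "'a::{field,finite} poly" and b :: "'a alg_closure"
  assumes f: "irreducible f" "ev b f = 0"
begin

text \<open>The values at \<open>b\<close> of the polynomials of degree below
  \<open>degree f\<close> form a set of \<open>CARD('a) ^ degree f\<close> elements that is stable
  under multiplication by \<open>b\<close>. For nonzero \<open>b\<close> this multiplication
  permutes the nonzero values, so their product is unchanged.\<close>

lemma root_power_CARD: "b ^ (CARD('a) ^ degree f) = b"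
proof (cases "b = 0")
  case True
  thus ?thesis by (simp add: power_0_left)
next
  case False
  define S where "S = ev b ` {g. degree g < degree f}"
  have deg: "degree f \<ge> 1" using degree_irreducible_pos[OF f(1)] by simp
  have finS: "finite S" and cardS: "card S = CARD('a) ^ degree f"
    unfolding S_def using card_degree_less[OF deg, where 'a = 'a] inj_on_eval_at[OF field_hom_to_ac f]
    by (simp_all add: card_image)
  have 0: "0 \<in> S" unfolding S_def using deg by (auto intro!: image_eqI[of _ _ 0] simp: ev_simps)
  have "(\<lambda>z. b * z) ` (S - {0}) \<subseteq> S - {0}"
  proof (rule image_subsetI)
    fix z assume z: "z \<in> S - {0}"
    then obtain g where g: "z = ev b g" by (auto simp: S_def)
    have "b * z = ev b (monom 1 1 * g)" by (simp add: g ev_simps)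
    also have "\<dots> = ev b ((monom 1 1 * g) mod f)"
      using eval_at_mod[OF field_hom_to_ac f(2)] by simp
    finally have eq: "b * z = ev b ((monom 1 1 * g) mod f)" .
    have "degree ((monom 1 1 * g) mod f) < degree f"
      using f(1) deg degree_mod_less[of f "monom 1 1 * g"] by force
    hence "b * z \<in> S" unfolding eq S_def by blast
    thus "b * z \<in> S - {0}" using z False by simp
  qed
  moreover have inj: "inj_on (\<lambda>z. b * z) (S - {0})" using False by (auto simp: inj_on_def)
  ultimately have "(\<lambda>z. b * z) ` (S - {0}) = S - {0}"
    using finS by (intro card_subset_eq) (auto simp: card_image)
  hence "(\<Prod>z\<in>S-{0}. z) = (\<Prod>z\<in>S-{0}. b * z)"
    using prod.reindex[OF inj, of "\<lambda>z. z"] by simp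
  also have "\<dots> = b ^ (CARD('a) ^ degree f - 1) * (\<Prod>z\<in>S-{0}. z)"
    using finS 0 cardS by (simp add: prod.distrib)
  finally have "b ^ (CARD('a) ^ degree f - 1) = 1"
    using finS by simp
  hence "b * b ^ (CARD('a) ^ degree f - 1) = b" by simp
  thus ?thesis by (simp flip: power_Suc)
qed

text \<open>If the power fixed \<open>b\<close>, it would fix all \<open>CARD('a) ^ degree f\<close>
  values of polynomials at \<open>b\<close>, more than \<open>fixed_points i\<close> can
  hold.\<close>

lemma root_power_CARD_neq:
  assumes "0 < i" "i < degree f"
  shows "b ^ (CARD('a) ^ i) \<noteq> b"
proof
  assume *: "b ^ (CARD('a) ^ i) = b"
  have deg: "degree f \<ge> 1" using assms by simp
  have "ev b ` {g. degree g < degree f} \<subseteq> fixed_points i"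
    using ev_frobenius[of b i, symmetric] * by (auto simp: fixed_points_def)
  hence "card (ev b ` {g. degree g < degree f}) \<le> CARD('a) ^ i"
    using card_mono[OF finite_fixed_points] card_fixed_points_le[of i, where 'a = 'a] assms le_trans
    by (metis less_eq_Suc_le One_nat_def)
  hence "CARD('a) ^ degree f \<le> CARD('a) ^ i"
    using card_degree_less[OF deg, where 'a = 'a] inj_on_eval_at[OF field_hom_to_ac f]
    by (simp add: card_image)
  moreover have "CARD('a) ^ i < CARD('a) ^ degree f"
    using CARD_field_ge_2[where 'a = 'a] assms by (intro power_strict_increasing) auto
  ultimately show False by simp
qed

lemma inj_on_conjugates: "inj_on (\<lambda>i. b ^ (CARD('a) ^ i)) {..<degree f}"
proof (rule linorder_inj_onI')
  fix i j assume ij: "i \<in> {..<degree f}" "j \<in> {..<degree f}" "i < j"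
  show "b ^ (CARD('a) ^ i) \<noteq> b ^ (CARD('a) ^ j)"
  proof
    assume "b ^ (CARD('a) ^ i) = b ^ (CARD('a) ^ j)"
    also have "\<dots> = (b ^ (CARD('a) ^ (j - i))) ^ (CARD('a) ^ i)"
      using ij by (simp flip: power_mult power_add)
    finally have "b ^ (CARD('a) ^ (j - i)) = b" using frobenius_inj by metis
    thus False using root_power_CARD_neq[of "j - i"] ij by (simp add: less_imp_diff_less)
  qed
qed

lemma root_power_CARD_periodic: "b ^ (CARD('a) ^ (i + degree f * l)) = b ^ (CARD('a) ^ i)"
proof (induction l)
  case (Suc l)
  have "b ^ (CARD('a) ^ (i + degree f * Suc l)) = (b ^ (CARD('a) ^ degree f)) ^ (CARD('a) ^ (i + degree f * l))"
    by (simp add: algebra_simps flip: power_mult power_add)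
  thus ?case by (simp add: root_power_CARD Suc)
qed simp

lemma conjugates_mod: "b ^ (CARD('a) ^ i) = b ^ (CARD('a) ^ (i mod degree f))"
  using root_power_CARD_periodic[of "i mod degree f" "i div degree f"] by simp

lemma fixed_points_iff_degree_dvd: "b \<in> fixed_points r \<longleftrightarrow> degree f dvd r"
proof
  assume "b \<in> fixed_points r"
  hence "b ^ (CARD('a) ^ (r mod degree f)) = b"
    using conjugates_mod[of r] by (simp add: fixed_points_def)
  thus "degree f dvd r"
    using root_power_CARD_neq[of "r mod degree f"] degree_irreducible_pos[OF f(1)]
    by (metis bot_nat_0.not_eq_extremum mod_less_divisor mod_greater_zero_iff_not_dvd)
next
  assume "degree f dvd r"
  thus "b \<in> fixed_points r"
    using root_power_CARD_periodic[of 0] by (auto simp: fixed_points_def elim!: dvdE)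
qed

lemma map_poly_eq_prod_conjugates:
  assumes "lead_coeff f = 1"
  shows "map_poly to_ac f = (\<Prod>i<degree f. [:- (b ^ (CARD('a) ^ i)), 1:])"
proof (rule poly_eqI_degree_lead_coeff[where n = "degree f" and A = "(\<lambda>i. b ^ (CARD('a) ^ i)) ` {..<degree f}"])
  interpret field_hom "to_ac :: 'a \<Rightarrow> 'a alg_closure" by (rule field_hom_to_ac)
  have deg: "degree (\<Prod>i<degree f. [:- (b ^ (CARD('a) ^ i)), 1:]) = degree f"
    by (subst degree_prod_eq_sum_degree) auto
  have "lead_coeff (\<Prod>i<degree f. [:- (b ^ (CARD('a) ^ i)), 1:]) = 1"
    by (simp add: lead_coeff_prod)
  thus "coeff (map_poly to_ac f) (degree f) = coeff (\<Prod>i<degree f. [:- (b ^ (CARD('a) ^ i)), 1:]) (degree f)"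
    using assms by (simp add: deg coeff_map_poly)
  show "degree (map_poly to_ac f) \<le> degree f" by simp
  show "degree (\<Prod>i<degree f. [:- (b ^ (CARD('a) ^ i)), 1:]) \<le> degree f" by (simp add: deg)
  show "degree f \<le> card ((\<lambda>i. b ^ (CARD('a) ^ i)) ` {..<degree f})"
    by (simp add: card_image[OF inj_on_conjugates])
  fix z assume "z \<in> (\<lambda>i. b ^ (CARD('a) ^ i)) ` {..<degree f}"
  then obtain i where i: "i < degree f" "z = b ^ (CARD('a) ^ i)" by blast
  have "poly (map_poly to_ac f) z = 0"
    using ev_frobenius[of b i f] f(2) i by (simp add: eval_at_def power_0_left)
  moreover have "poly (\<Prod>i<degree f. [:- (b ^ (CARD('a) ^ i)), 1:]) z = 0"
    using i by (auto simp: poly_prod intro!: prod_zero bexI[of _ i])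
  ultimately show "poly (map_poly to_ac f) z = poly (\<Prod>i<degree f. [:- (b ^ (CARD('a) ^ i)), 1:]) z"
    by simp
qed

end

section \<open>Primary polynomials and elements of finite extensions\<close>

lemma prod_block_shift: "(\<Prod>i\<in>{m..<m + n :: nat}. h i) = (\<Prod>i<n. h (i + m))"
  using prod.shift_bounds_nat_ivl[of h 0 m n] by (simp add: lessThan_atLeast0 add.commute)

text \<open>For \<open>g = p ^ k\<close> with \<open>r = k * degree p\<close>, the first
  \<open>r\<close> Frobenius powers of \<open>b\<close> run \<open>k\<close> times through the
  \<open>degree p\<close> distinct roots of \<open>p\<close>.\<close>

lemma
  fixes g :: "'a::{field,finite} poly"
  assumes g: "g \<in> primary_polys r" and b: "ev b g = 0"
  shows map_primary_poly: "map_poly to_ac g = (\<Prod>i<r. [:- (b ^ (CARD('a) ^ i)), 1:])"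
    and root_primary_poly_fixed: "b \<in> fixed_points r"
    and roots_primary_poly: "card {x. ev x g = 0} = base_degree g"
proof -
  interpret field_hom "to_ac :: 'a \<Rightarrow> 'a alg_closure" by (rule field_hom_to_ac)
  interpret mp: map_poly_comm_ring_hom "to_ac :: 'a \<Rightarrow> 'a alg_closure" ..
  obtain p k where p: "irreducible p" "lead_coeff p = 1" "k \<ge> 1" "g = p ^ k" "r = k * degree p"
    using g by (elim primary_polysE)
  have pb: "ev b p = 0" using b p by (simp add: ev_simps)
  note mapp = map_poly_eq_prod_conjugates[OF p(1) pb p(2)]
  show "b \<in> fixed_points r"
    using fixed_points_iff_degree_dvd[OF p(1) pb] p by simp
  have "(\<Prod>i<r. [:- (b ^ (CARD('a) ^ i)), 1:])
      = (\<Prod>l<k. \<Prod>i\<in>{l * degree p..<l * degree p + degree p}. [:- (b ^ (CARD('a) ^ i)), 1:])"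
    unfolding p(5) by (rule prod.nat_group[symmetric])
  also have "\<dots> = (\<Prod>l<k. \<Prod>i<degree p. [:- (b ^ (CARD('a) ^ i)), 1:])"
  proof (rule prod.cong[OF refl])
    fix l
    show "(\<Prod>i\<in>{l * degree p..<l * degree p + degree p}. [:- (b ^ (CARD('a) ^ i)), 1:])
        = (\<Prod>i<degree p. [:- (b ^ (CARD('a) ^ i)), 1:])"
      unfolding prod_block_shift mult.commute[of l] root_power_CARD_periodic[OF p(1) pb] ..
  qed
  also have "\<dots> = map_poly to_ac g"
    unfolding mapp[symmetric] p(4) by (simp add: hom_distribs)
  finally show "map_poly to_ac g = (\<Prod>i<r. [:- (b ^ (CARD('a) ^ i)), 1:])" ..
  have "{x. ev x g = 0} = {x. ev x p = 0}"
    using p by (auto simp: ev_simps)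
  also have "\<dots> = (\<lambda>i. b ^ (CARD('a) ^ i)) ` {..<degree p}"
    unfolding eval_at_def mapp by (auto simp: poly_prod)
  finally have "{x. ev x g = 0} = (\<lambda>i. b ^ (CARD('a) ^ i)) ` {..<degree p}" .
  thus "card {x. ev x g = 0} = base_degree g"
    using p by (simp add: card_image[OF inj_on_conjugates[OF p(1) pb]] base_degree_power)
qed

lemma ex_irreducible_annihilator:
  fixes b :: "'a::{field,finite} alg_closure"
  assumes "b \<in> fixed_points r" "r \<ge> 1"
  obtains p :: "'a poly" where "irreducible p" "lead_coeff p = 1" "ev b p = 0"
proof -
  define R where "R = (\<lambda>p::'a poly. p \<noteq> 0 \<and> ev b p = 0)"
  have "R (monom 1 (CARD('a) ^ r) - monom 1 1)"
    using assms degree_frobenius_poly[OF assms(2), where 'a = 'a and 'c = 'a]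
    by (force simp: R_def ev_simps fixed_points_def)
  define p where "p = arg_min degree R"
  have p: "p \<noteq> 0" "ev b p = 0" and min: "\<And>s. s \<noteq> 0 \<Longrightarrow> ev b s = 0 \<Longrightarrow> degree p \<le> degree s"
    using arg_min_nat_lemma[of R _ degree, OF \<open>R _\<close>] unfolding p_def by (auto simp: R_def)
  have "irreducible p"
  proof (rule irreducibleI)
    show "\<not> is_unit p"
    proof
      assume "is_unit p"
      then obtain t where "p * t = 1" by (metis dvdE)
      hence "ev b p * ev b t = 1" by (metis ev_simps(1,7))
      thus False using p by simp
    qed
    fix s t assume st: "p = s * t"
    hence nz: "s \<noteq> 0" "t \<noteq> 0" using p by auto
    hence deg: "degree p = degree s + degree t" using st by (simp add: degree_mult_eq)
    have "ev b s = 0 \<or> ev b t = 0" using p(2) st by (simp add: ev_simps)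
    hence "degree s = 0 \<or> degree t = 0" using min[of s] min[of t] nz deg by auto
    thus "is_unit s \<or> is_unit t" using nz by (auto simp: is_unit_iff_degree)
  qed (rule p)
  moreover define s where "s = smult (inverse (lead_coeff p)) p"
  ultimately have "irreducible s" using p by (auto intro: irreducible_smult_field)
  moreover have "lead_coeff s = 1" using p by (simp add: s_def)
  moreover have "ev b s = 0"
    using p ev_simps(1)[of b "[:inverse (lead_coeff p):]" p] by (simp add: s_def)
  ultimately show ?thesis using that by blast
qed

text \<open>Existence: the degree of the minimal polynomial of \<open>b\<close> divides
  \<open>r\<close>, so a suitable power has degree \<open>r\<close>. Uniqueness:
  \<open>map_primary_poly\<close> expresses \<open>g\<close> through \<open>b\<close> and
  \<open>r\<close> alone.\<close>

lemma ex1_primary_poly: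
  fixes b :: "'a::{field,finite} alg_closure"
  assumes "b \<in> fixed_points r" "r \<ge> 1"
  shows "\<exists>!g. g \<in> primary_polys r \<and> ev b g = 0"
proof -
  obtain p :: "'a poly" where p: "irreducible p" "lead_coeff p = 1" "ev b p = 0"
    using ex_irreducible_annihilator[OF assms] .
  obtain k where k: "r = degree p * k"
    using assms(1) fixed_points_iff_degree_dvd[OF p(1,3)] unfolding dvd_def by blast
  have k1: "k \<ge> 1" using k assms(2) by (cases k) auto
  have "p ^ k \<in> primary_polys r" using p k k1 by (intro primary_polysI) auto
  moreover have "ev b (p ^ k) = 0" using p k1 by (simp add: ev_simps)
  moreover have "g = h" if "g \<in> primary_polys r \<and> ev b g = 0" "h \<in> primary_polys r \<and> ev b h = 0" for g h
  proof (rule map_poly_field_hom_inj[OF field_hom_to_ac])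
    have "map_poly to_ac g = (\<Prod>i<r. [:- (b ^ (CARD('a) ^ i)), 1:])"
      using that(1) map_primary_poly by blast
    also have "\<dots> = map_poly to_ac h"
      using that(2) map_primary_poly[of h r b] by (elim conjE) (rule sym)
    finally show "map_poly to_ac g = map_poly to_ac h" .
  qed
  ultimately show ?thesis by blast
qed

text \<open>For \<open>b\<close> in \<open>fixed_points r\<close> with \<open>r \<ge> 1\<close>,
  this is the characteristic polynomial of multiplication by \<open>b\<close> on the extension of
  degree \<open>r\<close>.\<close>

definition primary_of :: "nat \<Rightarrow> 'a::{field,finite} alg_closure \<Rightarrow> 'a poly" where
  "primary_of r b = (THE g. g \<in> primary_polys r \<and> ev b g = 0)"

lemma
  assumes "b \<in> fixed_points r" "r \<ge> 1"
  shows primary_of_in: "primary_of r b \<in> primary_polys r"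
    and ev_primary_of: "ev b (primary_of r b) = 0"
  using theI'[OF ex1_primary_poly[OF assms]] by (simp_all add: primary_of_def)

lemma primary_of_eqI:
  assumes "g \<in> primary_polys r" "ev b g = 0" "r \<ge> 1"
  shows "primary_of r b = g"
  unfolding primary_of_def
  using ex1_primary_poly[OF root_primary_poly_fixed[OF assms(1,2)] assms(3)] assms
  by (intro the1_equality) simp_all

lemma primary_poly_has_root:
  fixes g :: "'a::{field,finite} poly"
  assumes "g \<in> primary_polys r"
  obtains b where "ev b g = 0"
proof -
  have "degree (map_poly to_ac g) = degree g" by (rule degree_map_poly) simp
  moreover have "degree g > 0" using assms by (auto simp: primary_polys_def primary_poly_def)
  ultimately show ?thesis
    using that alg_closed_imp_poly_has_root[of "map_poly to_ac g"] by (auto simp: eval_at_def)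
qed

text \<open>Each \<open>g\<close> has exactly \<open>base_degree g\<close> distinct roots in the
  closure, and each point of \<open>fixed_points r\<close> is a root of exactly one
  \<open>g\<close>, so the weight counts points.\<close>

lemma sum_primary_polys_eq_sum_fixed_points:
  fixes \<psi> :: "'a::{field,finite} poly \<Rightarrow> 'c::comm_ring_1"
  assumes r: "r \<ge> 1"
  shows "(\<Sum>g\<in>primary_polys r. of_nat (base_degree g) * \<psi> g) = (\<Sum>b\<in>fixed_points r. \<psi> (primary_of r b))"
proof -
  have roots: "{x. ev x g = 0} \<subseteq> fixed_points r" if "g \<in> primary_polys r" for g :: "'a poly"
    using root_primary_poly_fixed[OF that] by auto
  have fin: "finite {x. ev x g = 0}" if "g \<in> primary_polys r" for g :: "'a poly"
    using roots[OF that] finite_fixed_points[OF r] finite_subset by blast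
  have "(\<Sum>g\<in>primary_polys r. of_nat (base_degree g) * \<psi> g) = (\<Sum>g\<in>primary_polys r. \<Sum>x | ev x g = 0. \<psi> g)"
  proof (intro sum.cong refl)
    fix g :: "'a poly" assume g: "g \<in> primary_polys r"
    obtain b where "ev b g = 0" using primary_poly_has_root[OF g] .
    from roots_primary_poly[OF g this]
    show "of_nat (base_degree g) * \<psi> g = (\<Sum>x | ev x g = 0. \<psi> g)" by simp
  qed
  also have "\<dots> = (\<Sum>(g, x)\<in>(SIGMA g:primary_polys r. {x. ev x g = 0}). \<psi> g)"
    using fin by (intro sum.Sigma) auto
  also have "\<dots> = (\<Sum>b\<in>fixed_points r. \<psi> (primary_of r b))"
  proof (rule sum.reindex_bij_witness[of _ "\<lambda>b. (primary_of r b, b)" snd])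
    fix z assume "z \<in> (SIGMA g:(primary_polys r :: 'a poly set). {x. ev x g = 0})"
    then obtain g x where z: "z = (g, x)" "g \<in> primary_polys r" "ev x g = 0" by auto
    from primary_of_eqI[OF z(2,3) r] z(1) show "(primary_of r (snd z), snd z) = z" by simp
    from root_primary_poly_fixed[OF z(2,3)] z(1) show "snd z \<in> fixed_points r" by simp
    from primary_of_eqI[OF z(2,3) r] z(1)
    show "\<psi> (primary_of r (snd z)) = (case z of (g, x) \<Rightarrow> \<psi> g)" by simp
  next
    fix b :: "'a alg_closure" assume b: "b \<in> fixed_points r"
    show "(primary_of r b, b) \<in> (SIGMA g:primary_polys r. {x. ev x g = 0})"
      using primary_of_in[OF b r] ev_primary_of[OF b r] by simp
  qed simp
  finally show ?thesis .
qed

lemma card_fixed_points: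
  assumes "r \<ge> 1"
  shows "card (fixed_points r :: 'a::{field,finite} alg_closure set) = CARD('a) ^ r"
proof -
  have "int (card (fixed_points r :: 'a alg_closure set)) = int (\<Sum>g\<in>(primary_polys r :: 'a poly set). base_degree g)"
    using sum_primary_polys_eq_sum_fixed_points[OF assms, of "\<lambda>_::'a poly. 1 :: int"] by simp
  thus ?thesis using sum_base_degree_primary_polys[OF assms, where 'a = 'a] by simp
qed

lemma ev_primary_of_eq_prod:
  fixes b :: "'a::{field,finite} alg_closure"
  assumes "b \<in> fixed_points r" "r \<ge> 1"
  shows "ev a (primary_of r b) = (\<Prod>i<r. a - b ^ (CARD('a) ^ i))"
  using map_primary_poly[OF primary_of_in[OF assms] ev_primary_of[OF assms]]
  by (simp add: eval_at_def poly_prod)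

section \<open>Norms as powers of a fixed polynomial\<close>

lemma geometric_sum_nat: "(x - 1) * (\<Sum>j<k. x ^ j) + 1 = (x :: nat) ^ k" if "x \<ge> 1"
proof (induction k)
  case (Suc k)
  have "(x - 1) * (\<Sum>j<Suc k. x ^ j) + 1 = (x - 1) * x ^ k + x ^ k"
    using Suc by (simp add: algebra_simps)
  also have "\<dots> = (x - 1 + 1) * x ^ k" by (simp only: distrib_right mult_1)
  also have "\<dots> = x ^ Suc k" using that by simp
  finally show ?case .
qed simp

text \<open>
  The value \<open>\<Prod>\<^sub>i (a - b\<^bsup>q\<^sup>i\<^esup>)\<close> is a power of a polynomial in \<open>b\<close> (norm from the field with
  \<open>q\<^bsup>2nk\<^esup>\<close> to the one with \<open>q\<^sup>n\<close> elements), which has \<open>a\<close> as a simple root.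
\<close>
definition shifted_norm_poly :: "nat \<Rightarrow> 'a::{field,finite} alg_closure \<Rightarrow> 'a alg_closure poly" where
  "shifted_norm_poly n a = (\<Prod>i<n. [:a ^ (CARD('a) ^ (i * (n - 1))) - a, 1:] ^ (CARD('a) ^ i))"

context
  fixes f :: "'a::{field,finite} poly" and a :: "'a alg_closure" and n :: nat
  assumes f: "irreducible f" "degree f = n" "ev a f = 0" and n: "n \<ge> 2"
begin

lemma power_CARD_multiple_degree: "a ^ (CARD('a) ^ (n * l)) = a"
  using root_power_CARD_periodic[OF f(1,3), of 0 l] f(2) by simp

text \<open>The exponents \<open>i * (n - 1)\<close> and \<open>i\<close> add up to a multiple of
  the degree, so the inner power is the \<open>CARD('a) ^ i\<close>-th root of \<open>a\<close>.
  This explains the shifts in \<open>shifted_norm_poly\<close>.\<close>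

lemma conjugate_power_CARD: "(a ^ (CARD('a) ^ (i * (n - 1)))) ^ (CARD('a) ^ i) = a"
proof -
  have "i * (n - 1) + i = n * i" using n by (cases n) (auto simp: algebra_simps)
  thus ?thesis using power_CARD_multiple_degree[of i] by (simp flip: power_mult power_add)
qed

lemma shifted_norm_poly_nonzero: "shifted_norm_poly n a \<noteq> 0"
  by (simp add: shifted_norm_poly_def)

text \<open>The factor for \<open>i = 0\<close> is the variable itself, since its shift
  \<open>a - a\<close> is zero. Another factor vanishing at 0 would make \<open>a\<close> a fixed
  point of the \<open>i\<close>-th Frobenius power with \<open>0 < i < n\<close>, impossible for a
  root of \<open>f\<close>.\<close>

lemma order_shifted_norm_poly: "order 0 (shifted_norm_poly n a) = 1"
proof -
  define h where "h = (\<lambda>i. [:a ^ (CARD('a) ^ (i * (n - 1))) - a, 1:] ^ (CARD('a) ^ i))"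
  have "shifted_norm_poly n a = h 0 * (\<Prod>i\<in>{1..<n}. h i)"
    unfolding shifted_norm_poly_def h_def[symmetric] using n
    by (simp add: lessThan_atLeast0 prod.atLeast_Suc_lessThan)
  also have "h 0 = [:0, 1:]" by (simp add: h_def)
  finally have eq: "shifted_norm_poly n a = [:-0, 1:] ^ 1 * (\<Prod>i\<in>{1..<n}. h i)" by simp
  have "poly (\<Prod>i\<in>{1..<n}. h i) 0 \<noteq> 0"
  proof
    assume "poly (\<Prod>i\<in>{1..<n}. h i) 0 = 0"
    then obtain i where i: "1 \<le> i" "i < n" "a ^ (CARD('a) ^ (i * (n - 1))) = a"
      by (auto simp: poly_prod h_def)
    hence "a ^ (CARD('a) ^ i) = a" using conjugate_power_CARD[of i] by simp
    thus False using root_power_CARD_neq[OF f(1,3), of i] i f(2) by simp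
  qed
  hence "order 0 (\<Prod>i\<in>{1..<n}. h i) = 0" by (rule order_0I)
  moreover have "order 0 (shifted_norm_poly n a) = order 0 ([:-0, 1:] ^ 1 :: 'a alg_closure poly) + order 0 (\<Prod>i\<in>{1..<n}. h i)"
    using shifted_norm_poly_nonzero unfolding eq by (rule order_mult)
  ultimately show ?thesis by (simp only: order_power_n_n)
qed

text \<open>The factors are grouped in \<open>2 * k\<close> blocks of \<open>n\<close>. As the roots
  \<open>A i\<close> of \<open>a\<close> depend only on \<open>i\<close> modulo \<open>n\<close>,
  block \<open>j\<close> contributes the value of \<open>shifted_norm_poly\<close> to the power
  \<open>(q ^ n) ^ j\<close>. The sum of these exponents splits into the form
  \<open>w * (P + 1)\<close> that \<open>stepanov_bound\<close> asks for.\<close>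

lemma prod_eq_shifted_norm_power:
  assumes b: "b \<in> fixed_points (n * (2 * k))"
  shows "(\<Prod>i<n * (2 * k). a - b ^ (CARD('a) ^ i))
    = poly (shifted_norm_poly n a) (a - b) ^ ((\<Sum>j<k. (CARD('a) ^ n) ^ j) * ((CARD('a) ^ n) ^ k + 1))"
proof -
  define q where "q = CARD('a)"
  define A where "A = (\<lambda>i. a ^ (q ^ (i * (n - 1))))"
  have A: "a - b ^ (q ^ i) = (A i - b) ^ (q ^ i)" for i
    using conjugate_power_CARD[of i] unfolding A_def q_def by (simp add: frobenius_diff)
  have A_periodic: "A (i + j * n) = A i" for i j
  proof -
    have "A (i + j * n) = (a ^ (q ^ (n * (j * (n - 1))))) ^ (q ^ (i * (n - 1)))"
      unfolding A_def by (simp add: algebra_simps flip: power_mult power_add)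
    thus ?thesis using power_CARD_multiple_degree unfolding A_def q_def by simp
  qed
  have "(\<Prod>i<n * (2 * k). a - b ^ (q ^ i)) = (\<Prod>i<(2 * k) * n. (A i - b) ^ (q ^ i))"
    by (simp add: A mult.commute)
  also have "\<dots> = (\<Prod>j<2 * k. \<Prod>i\<in>{j * n..<j * n + n}. (A i - b) ^ (q ^ i))"
    by (rule prod.nat_group[symmetric])
  also have "\<dots> = (\<Prod>j<2 * k. \<Prod>i<n. (A i - b) ^ (q ^ (i + j * n)))"
  proof (rule prod.cong[OF refl])
    fix j
    show "(\<Prod>i\<in>{j * n..<j * n + n}. (A i - b) ^ (q ^ i)) = (\<Prod>i<n. (A i - b) ^ (q ^ (i + j * n)))"
      unfolding prod_block_shift A_periodic ..
  qed
  also have "\<dots> = (\<Prod>j<2 * k. poly (shifted_norm_poly n a) (a - b) ^ ((q ^ n) ^ j))"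
  proof (rule prod.cong[OF refl])
    fix j
    have "poly (shifted_norm_poly n a) (a - b) = (\<Prod>i<n. (A i - b) ^ (q ^ i))"
      by (simp add: shifted_norm_poly_def poly_prod A_def q_def)
    thus "(\<Prod>i<n. (A i - b) ^ (q ^ (i + j * n))) = poly (shifted_norm_poly n a) (a - b) ^ ((q ^ n) ^ j)"
      by (simp add: prod_power_distrib power_add mult.commute flip: power_mult)
  qed
  also have "\<dots> = poly (shifted_norm_poly n a) (a - b) ^ (\<Sum>j<2 * k. (q ^ n) ^ j)"
    by (simp add: power_sum)
  also have "(\<Sum>j<2 * k. (q ^ n) ^ j) = (\<Sum>j<k. (q ^ n) ^ j) * ((q ^ n) ^ k + 1)"
  proof -
    have "(\<Sum>j<k + m. (q ^ n) ^ j) = (\<Sum>j<k. (q ^ n) ^ j) + (q ^ n) ^ k * (\<Sum>j<m. (q ^ n) ^ j)" for m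
      by (induction m) (simp_all add: algebra_simps power_add)
    thus ?thesis unfolding mult_2 by (simp add: algebra_simps)
  qed
  finally show ?thesis unfolding q_def .
qed

end

section \<open>The character sum over primary polynomials\<close>

lemma exists_root_alg_closure:
  fixes f :: "'a::field poly"
  assumes "degree f > 0"
  obtains a where "ev a f = 0"
proof -
  have "degree (map_poly to_ac f) = degree f" by (rule degree_map_poly) simp
  thus ?thesis
    using that alg_closed_imp_poly_has_root[of "map_poly to_ac f"] assms by (auto simp: eval_at_def)
qed

context
  fixes \<iota> :: "'a::{field,finite} \<Rightarrow> 'b::{field,finite}" and f :: "'a poly" and \<alpha> :: 'b and n :: nat
  assumes hom: "field_hom \<iota>" and card: "CARD('b) = CARD('a) ^ n" and n: "n \<ge> 2"
    and f: "irreducible f" "degree f = n" "eval_at \<iota> \<alpha> f = 0"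
begin

lemma bij_betw_eval_at: "bij_betw (eval_at \<iota> \<alpha>) {g. degree g < n} UNIV"
proof -
  have inj: "inj_on (eval_at \<iota> \<alpha>) {g. degree g < n}"
    using inj_on_eval_at[OF hom f(1,3)] f(2) by simp
  moreover have "eval_at \<iota> \<alpha> ` {g. degree g < n} = UNIV"
    using n card card_degree_less[of n, where 'a = 'a] by (intro card_subset_eq) (auto simp: card_image[OF inj])
  ultimately show ?thesis by (simp add: bij_betw_def)
qed

text \<open>The map from \<open>b\<close> to \<open>a - b\<close> carries the fibre injectively into
  the set counted by \<open>stepanov_bound\<close>. Equal values at \<open>\<alpha>\<close> mean
  congruence modulo \<open>f\<close>, hence equal values at \<open>a\<close>, so one constant
  \<open>c\<close> serves the whole fibre.\<close>

lemma fibre_card_le: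
  fixes a :: "'a alg_closure" and z :: 'b
  defines "M \<equiv> CARD('a) ^ n - 1" and "D \<equiv> degree (shifted_norm_poly n a)"
  assumes a: "ev a f = 0" and z: "z \<noteq> 0" and k: "k \<ge> 1"
  defines "w \<equiv> (\<Sum>j<k. (CARD('a) ^ n) ^ j)"
  shows "card {b \<in> fixed_points (n * (2 * k)). eval_at \<iota> \<alpha> (primary_of (n * (2 * k)) b) = z}
    \<le> M * w * w + (2 * M * D + 2) * w + D"
proof (cases "{b \<in> fixed_points (n * (2 * k)) :: 'a alg_closure set. eval_at \<iota> \<alpha> (primary_of (n * (2 * k)) b) = z} = {}")
  case True
  show ?thesis unfolding True by simp
next
  case False
  define r where "r = n * (2 * k)"
  define P where "P = (CARD('a) ^ n) ^ k"
  define F where "F = shifted_norm_poly n a"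
  define N where "N = {b :: 'a alg_closure \<in> fixed_points r. eval_at \<iota> \<alpha> (primary_of r b) = z}"
  from False obtain b0 where b0: "b0 \<in> N" unfolding N_def r_def by blast
  define c where "c = ev a (primary_of r b0)"
  have r: "r \<ge> 1" using k n by (simp add: r_def)
  have q2: "CARD('a) \<ge> 2" by (rule CARD_field_ge_2)
  have qn: "4 \<le> CARD('a) ^ n"
  proof -
    have "(4 :: nat) = 2 ^ 2" by simp
    also have "\<dots> \<le> 2 ^ n" using n by (intro power_increasing) auto
    also have "\<dots> \<le> CARD('a) ^ n" by (rule power_mono[OF q2]) simp
    finally show ?thesis .
  qed
  have PM: "P = M * w + 1"
    using geometric_sum_nat[of "CARD('a) ^ n" k] qn by (simp add: P_def M_def w_def)
  have w1: "w \<ge> 1"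
  proof -
    have "(\<Sum>j\<in>{0}. (CARD('a) ^ n) ^ j) \<le> w"
      unfolding w_def using k by (intro sum_mono2) auto
    thus ?thesis by simp
  qed
  obtain e where "CARD('a) ^ (n * k) = CHAR('a alg_closure) ^ e" by (rule CARD_power_eq_CHAR_power)
  hence e: "P = CHAR('a alg_closure) ^ e" by (simp add: P_def power_mult)
  \<comment> \<open>The factor 2 in the degree makes the field order a square \<open>P * P\<close>,
    as Stepanov's bound requires.\<close>
  have PP: "P * P = CARD('a) ^ r"
    unfolding P_def r_def by (simp only: power_add[symmetric] power_mult[symmetric] mult_2 distrib_left)
  have same_value: "ev a (primary_of r b) = c" if "b \<in> N" for b
  proof -
    have "eval_at \<iota> \<alpha> (primary_of r b - primary_of r b0) = 0"
      using that b0 by (simp add: N_def eval_at_diff[OF hom])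
    hence "f dvd primary_of r b - primary_of r b0"
      using eval_at_eq_0_iff_dvd[OF hom f(1,3)] by blast
    hence "ev a (primary_of r b - primary_of r b0) = 0"
      using eval_at_eq_0_iff_dvd[OF field_hom_to_ac f(1) a] by blast
    thus ?thesis by (simp add: c_def ev_simps)
  qed
  have c0: "c \<noteq> 0"
    using z b0 eval_at_eq_0_iff_dvd[OF hom f(1,3)] eval_at_eq_0_iff_dvd[OF field_hom_to_ac f(1) a]
    by (auto simp: c_def N_def)
  have a_fixed: "a \<in> fixed_points r"
    using fixed_points_iff_degree_dvd[OF f(1) a] f(2) by (simp add: r_def)
  define T where "T = {b. b ^ (P * P) = b \<and> poly F b ^ (w * (P + 1)) = c}"
  have "(\<lambda>b. a - b) ` N \<subseteq> T"
  proof (rule image_subsetI)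
    fix b assume b: "b \<in> N"
    hence bf: "b \<in> fixed_points r" by (simp add: N_def)
    have "(a - b) ^ (P * P) = a - b"
      using a_fixed bf unfolding PP fixed_points_def by (simp add: frobenius_diff)
    moreover have "poly F (a - b) ^ (w * (P + 1)) = c"
      using prod_eq_shifted_norm_power[OF f(1,2) a n bf[unfolded r_def]] ev_primary_of_eq_prod[OF bf r, of a]
        same_value[OF b]
      by (simp only: F_def w_def P_def r_def)
    ultimately show "a - b \<in> T" by (simp add: T_def)
  qed
  moreover have "finite T"
  proof (rule finite_subset)
    show "T \<subseteq> fixed_points r" by (auto simp: T_def PP fixed_points_def)
  qed (rule finite_fixed_points[OF r])
  ultimately have "card N \<le> card T"
    by (intro card_inj_on_le[of "\<lambda>b. a - b"]) (auto simp: inj_on_def)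
  also have "\<dots> \<le> M * w * w + (2 * M * D + 2) * w + D"
    unfolding T_def D_def F_def[symmetric]
    using qn order_shifted_norm_poly[OF f(1,2) a n] shifted_norm_poly_nonzero[OF f(1,2) a n]
    by (intro stepanov_bound[OF prime_CHAR_alg_closure e PM _ w1 _ _ c0]) (auto simp: M_def F_def)
  finally show ?thesis unfolding N_def r_def .
qed

section \<open>Character sums over monic and primary polynomials\<close>

context
  fixes \<chi> :: "'b \<Rightarrow> complex"
  assumes \<chi>0: "\<chi> 0 = 0" and \<chi>_mult: "\<And>x y. \<chi> (x * y) = \<chi> x * \<chi> y"
    and \<chi>_norm: "\<And>z. z \<noteq> 0 \<Longrightarrow> cmod (\<chi> z) = 1" and \<chi>_sum: "(\<Sum>z\<in>UNIV. \<chi> z) = 0"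
begin

text \<open>Adding a polynomial of degree below \<open>n\<close> permutes \<open>monics d\<close>.
  Averaging over these shifts lets each value run through the whole field, where
  \<open>\<chi>\<close> sums to zero. Hence the L-series is a polynomial.\<close>

lemma character_sum_monics_eq_0:
  assumes "d \<ge> n"
  shows "(\<Sum>g\<in>monics d. \<chi> (eval_at \<iota> \<alpha> g)) = 0"
proof -
  define L where "L = {s :: 'a poly. degree s < n}"
  have cardL: "card L = CARD('a) ^ n" using card_degree_less(2)[of n, where 'a = 'a] n by (simp add: L_def)
  have shift: "(\<Sum>g\<in>monics d. \<chi> (eval_at \<iota> \<alpha> (g + s))) = (\<Sum>g\<in>monics d. \<chi> (eval_at \<iota> \<alpha> g))" if "s \<in> L" for s
  proof (rule sum.reindex_bij_witness[of _ "\<lambda>g. g - s" "\<lambda>g. g + s"])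
    have monics_add: "g + t \<in> monics d" if "g \<in> monics d" "degree t < n" for g t :: "'a poly"
      using that assms by (auto simp: monics_def degree_add_eq_left coeff_eq_0)
    show "g + s \<in> monics d" if "g \<in> monics d" for g
      using monics_add[OF that, of s] \<open>s \<in> L\<close> by (simp add: L_def)
    show "g - s \<in> monics d" if "g \<in> monics d" for g
      using monics_add[OF that, of "- s"] \<open>s \<in> L\<close> by (simp add: L_def)
  qed auto
  have "of_nat (card L) * (\<Sum>g\<in>monics d. \<chi> (eval_at \<iota> \<alpha> g)) = (\<Sum>s\<in>L. \<Sum>g\<in>monics d. \<chi> (eval_at \<iota> \<alpha> (g + s)))"
    using shift by simp
  also have "\<dots> = (\<Sum>g\<in>monics d. \<Sum>s\<in>L. \<chi> (eval_at \<iota> \<alpha> g + eval_at \<iota> \<alpha> s))"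
    by (subst sum.swap) (simp add: eval_at_add[OF hom])
  also have "\<dots> = 0"
  proof (rule sum.neutral, rule ballI)
    fix g
    have "(\<Sum>s\<in>L. \<chi> (eval_at \<iota> \<alpha> g + eval_at \<iota> \<alpha> s)) = (\<Sum>z\<in>UNIV. \<chi> (eval_at \<iota> \<alpha> g + z))"
      unfolding L_def by (rule sum.reindex_bij_betw[OF bij_betw_eval_at])
    also have "\<dots> = (\<Sum>z\<in>UNIV. \<chi> z)"
      by (rule sum.reindex_bij_witness[of _ "\<lambda>z. z - eval_at \<iota> \<alpha> g" "\<lambda>z. eval_at \<iota> \<alpha> g + z"]) auto
    finally show "(\<Sum>s\<in>L. \<chi> (eval_at \<iota> \<alpha> g + eval_at \<iota> \<alpha> s)) = 0" using \<chi>_sum by simp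
  qed
  finally show ?thesis using cardL by simp
qed

text \<open>
  An upper bound for all fibres of \<open>b \<mapsto> z\<close> suffices: as the fibres add up to \<open>q\<^bsup>2nk\<^esup>\<close>, it
  also bounds the total deviation from equidistribution, which is what \<open>\<chi>\<close> sees.
\<close>
lemma character_sum_weak_bound:
  "\<exists>C. \<forall>k\<ge>1. cmod (\<Sum>g\<in>primary_polys (n * (2 * k)). of_nat (base_degree g) * \<chi> (eval_at \<iota> \<alpha> g))
     \<le> C * (real CARD('a) ^ n) ^ k"
proof -
  obtain a where a: "ev a f = 0"
    using exists_root_alg_closure[of f] degree_irreducible_pos[OF f(1)] by blast
  define M where "M = CARD('a) ^ n - 1"
  define D where "D = degree (shifted_norm_poly n a)"
  have "CARD('a) ^ n > 1" using CARD_field_ge_2[where 'a = 'a] n by (intro one_less_power) auto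
  hence M1: "M \<ge> 1" by (simp add: M_def)
  have cardM: "card (UNIV - {0 :: 'b}) = M" using card by (simp add: M_def)
  have "cmod (\<Sum>g\<in>primary_polys (n * (2 * k)). of_nat (base_degree g) * \<chi> (eval_at \<iota> \<alpha> g))
      \<le> real (M * (2 * M * D + 2) + M * D + D) * (real CARD('a) ^ n) ^ k" if k: "k \<ge> 1" for k
  proof -
    define r where "r = n * (2 * k)"
    define P where "P = (CARD('a) ^ n) ^ k"
    define w where "w = (\<Sum>j<k. (CARD('a) ^ n) ^ j)"
    define E where "E = (\<lambda>b::'a alg_closure. eval_at \<iota> \<alpha> (primary_of r b))"
    define N where "N = (\<lambda>z. card {b \<in> fixed_points r. E b = z})"
    define U where "U = M * w * w + (2 * M * D + 2) * w + D"
    have r: "r \<ge> 1" using k n by (simp add: r_def)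
    have fin: "finite (fixed_points r :: 'a alg_closure set)" by (rule finite_fixed_points[OF r])
    have PM: "P = M * w + 1"
      using geometric_sum_nat[of "CARD('a) ^ n" k] by (simp add: P_def M_def w_def)
    have w1: "w \<ge> 1"
    proof -
      have "(\<Sum>j\<in>{0}. (CARD('a) ^ n) ^ j) \<le> w"
        unfolding w_def using k by (intro sum_mono2) auto
      thus ?thesis by simp
    qed
    have wP: "w \<le> P" using PM M1 by (metis le_add1 mult_le_mono1 nat_mult_1 trans_le_add1)
    have NU: "N z \<le> U" if "z \<noteq> 0" for z
      using fibre_card_le[OF a that k] unfolding N_def E_def r_def U_def M_def D_def w_def .
    have PP: "P * P = CARD('a) ^ r"
      unfolding P_def r_def by (simp only: power_add[symmetric] power_mult[symmetric] mult_2 distrib_left)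
    have total: "N 0 + (\<Sum>z\<in>UNIV-{0}. N z) = P * P"
    proof -
      have "(\<Sum>z\<in>UNIV. N z) = card (fixed_points r :: 'a alg_closure set)"
        using sum.group[OF fin, of UNIV E "\<lambda>_. 1 :: nat"] by (simp add: N_def)
      thus ?thesis
        using card_fixed_points[OF r, where 'a = 'a]
        by (simp add: sum.remove[of UNIV 0] PP)
    qed
    \<comment> \<open>The points over 0 escape the Stepanov bound, but for them \<open>a - b\<close>
      is a root of \<open>shifted_norm_poly n a\<close>.\<close>
    have N0: "N 0 \<le> D"
    proof -
      have "a - b \<in> {t. poly (shifted_norm_poly n a) t = 0}" if "b \<in> fixed_points r" "E b = 0" for b
      proof -
        have "f dvd primary_of r b"
          using that(2) eval_at_eq_0_iff_dvd[OF hom f(1,3)] by (simp add: E_def)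
        hence "ev a (primary_of r b) = 0"
          using eval_at_eq_0_iff_dvd[OF field_hom_to_ac f(1) a] by blast
        thus ?thesis
          using prod_eq_shifted_norm_power[OF f(1,2) a n that(1)[unfolded r_def]]
            ev_primary_of_eq_prod[OF that(1) r, of a] by (simp add: r_def)
      qed
      hence "(\<lambda>b. a - b) ` {b \<in> fixed_points r. E b = 0} \<subseteq> {t. poly (shifted_norm_poly n a) t = 0}"
        by blast
      from card_mono[OF poly_roots_finite this]
      have "N 0 \<le> card {t. poly (shifted_norm_poly n a) t = 0}"
        using shifted_norm_poly_nonzero[OF f(1,2) a n] by (simp add: card_image inj_on_def N_def)
      also have "\<dots> \<le> D"
        unfolding D_def by (rule card_poly_roots_bound[OF shifted_norm_poly_nonzero[OF f(1,2) a n]])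
      finally show ?thesis .
    qed
    have "(\<Sum>g\<in>primary_polys r. of_nat (base_degree g) * \<chi> (eval_at \<iota> \<alpha> g)) = (\<Sum>b\<in>fixed_points r. \<chi> (E b))"
      unfolding E_def by (rule sum_primary_polys_eq_sum_fixed_points[OF r])
    also have "\<dots> = (\<Sum>z\<in>UNIV. \<Sum>b | b \<in> fixed_points r \<and> E b = z. \<chi> (E b))"
      using fin by (intro sum.group[symmetric]) auto
    also have "\<dots> = (\<Sum>z\<in>UNIV. of_nat (N z) * \<chi> z)"
      by (simp add: N_def)
    also have "\<dots> = (\<Sum>z\<in>UNIV-{0}. of_nat (N z) * \<chi> z)"
      by (simp add: sum.remove[of UNIV 0] \<chi>0)
    \<comment> \<open>Subtracting the constant \<open>U\<close> from all multiplicities is free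
      because \<open>\<chi>\<close> sums to zero, and it leaves nonnegative deficits
      \<open>U - N z\<close>.\<close>
    also have "\<dots> = - (\<Sum>z\<in>UNIV-{0}. of_nat (U - N z) * \<chi> z)"
    proof -
      have "(\<Sum>z\<in>UNIV-{0}. of_nat (U - N z) * \<chi> z) = (\<Sum>z\<in>UNIV-{0}. of_nat U * \<chi> z - of_nat (N z) * \<chi> z)"
        using NU by (intro sum.cong) (auto simp: of_nat_diff algebra_simps)
      also have "\<dots> = of_nat U * (\<Sum>z\<in>UNIV-{0}. \<chi> z) - (\<Sum>z\<in>UNIV-{0}. of_nat (N z) * \<chi> z)"
        by (simp add: sum_subtractf sum_distrib_left)
      also have "(\<Sum>z\<in>UNIV-{0}. \<chi> z) = 0"
        using \<chi>_sum by (simp add: sum.remove[of UNIV 0] \<chi>0)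
      finally show ?thesis by simp
    qed
    finally have "cmod (\<Sum>g\<in>primary_polys r. of_nat (base_degree g) * \<chi> (eval_at \<iota> \<alpha> g))
        = cmod (\<Sum>z\<in>UNIV-{0}. of_nat (U - N z) * \<chi> z)" by simp
    also have "\<dots> \<le> (\<Sum>z\<in>UNIV-{0}. real (U - N z))"
      by (intro sum_norm_le) (auto simp: norm_mult \<chi>_norm)
    also have "\<dots> = real (\<Sum>z\<in>UNIV-{0}. U - N z)" by simp
    also have "(\<Sum>z\<in>UNIV-{0}. U - N z) \<le> (M * (2 * M * D + 2) + M * D + D) * P"
    proof -
      have "(\<Sum>z\<in>UNIV-{0}. U - N z) + (\<Sum>z\<in>UNIV-{0}. N z) = (\<Sum>z\<in>UNIV-{0::'b}. U)"
        unfolding sum.distrib[symmetric] using NU by (intro sum.cong) auto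
      also have "\<dots> = M * U" using cardM by simp
      \<comment> \<open>The total deficit is \<open>M * U\<close> minus the number of points over
        nonzero \<open>z\<close>. The leading part of \<open>M * U\<close> is the square of
        \<open>M * w\<close>, at most \<open>P * P\<close>, so what remains is linear in
        \<open>P\<close>.\<close>
      finally have "(\<Sum>z\<in>UNIV-{0}. U - N z) + P * P \<le> M * U + D" using total N0 by linarith
      also have "\<dots> = (M * w) * (M * w) + (M * (2 * M * D + 2) * w + (M * D + D) * 1)"
        by (simp add: U_def algebra_simps)
      also have "\<dots> \<le> P * P + (M * (2 * M * D + 2) * P + (M * D + D) * P)"
        using wP PM w1 by (intro add_mono mult_mono) auto
      finally show ?thesis by (simp add: algebra_simps)
    qed
    finally show ?thesis by (simp add: r_def P_def)
  qed
  thus ?thesis by blast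
qed

text \<open>The constant of the weak bound disappears: the same at most \<open>n - 1\<close> numbers
  \<open>w\<close> govern all exponents, so letting \<open>k\<close> grow determines their size, and
  the result serves every \<open>d\<close>.\<close>

theorem character_sum_primary_bound:
  assumes d: "d \<ge> 1"
  shows "cmod (\<Sum>g\<in>primary_polys d. of_nat (base_degree g) * \<chi> (eval_at \<iota> \<alpha> g))
    \<le> real (n - 1) * sqrt (real CARD('a)) ^ d"
proof -
  define q where "q = real CARD('a)"
  have q: "q \<ge> 2" using CARD_field_ge_2[where 'a = 'a] by (simp add: q_def)
  define c where "c = (\<lambda>d. \<Sum>g\<in>monics d. \<chi> (eval_at \<iota> \<alpha> g))"
  define S where "S = (\<lambda>d. \<Sum>g\<in>primary_polys d. of_nat (base_degree g) * \<chi> (eval_at \<iota> \<alpha> g))"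
  have "\<chi> 1 * \<chi> 1 = \<chi> 1" using \<chi>_mult[of 1 1] by simp
  moreover have "\<chi> 1 \<noteq> 0" using \<chi>_norm[of 1] by auto
  ultimately have \<chi>1: "\<chi> 1 = 1" by simp
  have c0: "c 0 = 1" using \<chi>1 by (simp add: c_def monics_0 eval_at_1[OF hom])
  have cn: "c d = 0" if "d \<ge> n" for d
    unfolding c_def by (rule character_sum_monics_eq_0[OF that])
  have newton: "of_nat d * c d = (\<Sum>i=1..d. S i * c (d - i))" for d
    unfolding c_def S_def
    by (rule newton_identity_primary_sums) (simp add: eval_at_mult[OF hom] \<chi>_mult)
  obtain ws where ws: "length ws \<le> n - 1" "\<And>d. d \<ge> 1 \<Longrightarrow> S d = - (\<Sum>w\<leftarrow>ws. w ^ d)"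
    using newton_recursion_roots[OF c0 cn newton] by blast
  obtain C where C: "\<And>k. k \<ge> 1 \<Longrightarrow> cmod (S (n * (2 * k))) \<le> C * (q ^ n) ^ k"
    using character_sum_weak_bound unfolding S_def q_def by blast
  have norm_le: "cmod w \<le> sqrt q" if w: "w \<in> set ws" for w
  proof -
    \<comment> \<open>The weak bound controls only exponents divisible by \<open>2 * n\<close>, so
      it is applied to the list of \<open>2 * n\<close>-th powers.\<close>
    have "cmod (w ^ (2 * n)) \<le> q ^ n"
    proof (rule power_sums_bound_imp_norm_bound)
      show "w ^ (2 * n) \<in> set (map (\<lambda>w. w ^ (2 * n)) ws)" using w by simp
      show "0 < q ^ n" using q by simp
      fix k :: nat assume k: "k \<ge> 1"
      have "(\<Sum>v\<leftarrow>map (\<lambda>w. w ^ (2 * n)) ws. v ^ k) = - S (n * (2 * k))"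
        using ws(2)[of "n * (2 * k)"] k n by (simp add: o_def mult_ac flip: power_mult)
      thus "cmod (\<Sum>v\<leftarrow>map (\<lambda>w. w ^ (2 * n)) ws. v ^ k) \<le> C * (q ^ n) ^ k"
        using C[OF k] by simp
    qed
    hence "cmod w ^ (2 * n) \<le> sqrt q ^ (2 * n)"
      using q by (simp add: norm_power power_mult)
    thus ?thesis using n q by (subst (asm) power_mono_iff) auto
  qed
  have "cmod (S d) = cmod (\<Sum>w\<leftarrow>ws. w ^ d)" using ws(2)[OF d] by simp
  also have "\<dots> \<le> (\<Sum>w\<leftarrow>ws. sqrt q ^ d)"
    using norm_le
  proof (induction ws)
    case (Cons w ws)
    have "cmod (w ^ d + (\<Sum>w\<leftarrow>ws. w ^ d)) \<le> cmod w ^ d + cmod (\<Sum>w\<leftarrow>ws. w ^ d)"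
      by (metis norm_power norm_triangle_ineq)
    also have "\<dots> \<le> sqrt q ^ d + (\<Sum>w\<leftarrow>ws. sqrt q ^ d)"
      using Cons by (intro add_mono power_mono) auto
    finally show ?case by simp
  qed simp
  also have "\<dots> = real (length ws) * sqrt q ^ d" by (simp add: sum_list_triv)
  also have "\<dots> \<le> real (n - 1) * sqrt q ^ d"
    using ws(1) q by (intro mult_right_mono) auto
  finally show ?thesis unfolding S_def q_def .
qed

end

end

section \<open>Eigenvalues\<close>

text \<open>Only proper powers of an irreducible \<open>p\<close> have a defect, and then
  \<open>degree p\<close> is at most \<open>d div 2\<close>. Since \<open>p\<close> and
  \<open>d\<close> determine the power, there are no more of them than monic polynomials of degree
  \<open>d div 2\<close>.\<close>

lemma sum_base_degree_defect_le:
  "(\<Sum>g\<in>(primary_polys d :: 'a::{field,finite} poly set). d - base_degree g) \<le> d * CARD('a) ^ (d div 2)"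
proof -
  define e where "e = d div 2"
  define B where "B = {g :: 'a poly \<in> primary_polys d. base_degree g < d}"
  have finB: "finite B" unfolding B_def by (rule finite_subset[of _ "primary_polys d"]) auto
  have "\<forall>g\<in>B. \<exists>p. irreducible p \<and> lead_coeff p = 1 \<and> degree p \<le> e \<and> g = p ^ (d div degree p)"
  proof
    fix g assume g: "g \<in> B"
    then obtain p k where p: "irreducible p" "lead_coeff p = 1" "k \<ge> 1" "g = p ^ k" "d = k * degree p"
      unfolding B_def by (auto elim: primary_polysE)
    have "degree p < k * degree p" using g p base_degree_power[OF p(1,3)] by (simp add: B_def)
    hence "k \<ge> 2" using p(3) by (cases "k = 1") auto
    hence "2 * degree p \<le> d" unfolding p(5) by (rule mult_le_mono1)
    hence "degree p \<le> e" by (simp add: e_def)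
    moreover have "d div degree p = k" using p degree_irreducible_pos[OF p(1)] by simp
    ultimately show "\<exists>p. irreducible p \<and> lead_coeff p = 1 \<and> degree p \<le> e \<and> g = p ^ (d div degree p)"
      using p by blast
  qed
  then obtain \<pi> where \<pi>: "\<And>g. g \<in> B \<Longrightarrow> irreducible (\<pi> g)" "\<And>g. g \<in> B \<Longrightarrow> lead_coeff (\<pi> g) = 1"
      "\<And>g. g \<in> B \<Longrightarrow> degree (\<pi> g) \<le> e" "\<And>g. g \<in> B \<Longrightarrow> g = \<pi> g ^ (d div degree (\<pi> g))"
    by (metis (no_types, lifting) bchoice)
  \<comment> \<open>Padding by a power of the variable brings every base to degree exactly
    \<open>e\<close>; by \<open>aux\<close>, the irreducible base can be recovered from the
    product.\<close>
  define \<phi> where "\<phi> = (\<lambda>g. \<pi> g * monom 1 (e - degree (\<pi> g)))"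
  have aux: "p = r" if "irreducible p" "irreducible r" "lead_coeff p = 1" "lead_coeff r = 1"
      "p * monom 1 i = r * monom 1 j" "i \<le> j" for p r :: "'a poly" and i j
  proof -
    have "p * monom 1 i = (r * monom 1 (j - i)) * monom 1 i"
      using that by (simp add: mult.assoc mult_monom)
    hence "r dvd p" by (simp add: monom_eq_0_iff)
    thus ?thesis using monic_irreducible_dvd_irreducible[of r p] that by simp
  qed
  have "inj_on \<phi> B"
  proof (rule inj_onI)
    fix g h assume gh: "g \<in> B" "h \<in> B" "\<phi> g = \<phi> h"
    have "\<pi> g = \<pi> h"
      using aux[of "\<pi> g" "\<pi> h" "e - degree (\<pi> g)" "e - degree (\<pi> h)"]
        aux[of "\<pi> h" "\<pi> g" "e - degree (\<pi> h)" "e - degree (\<pi> g)"] \<pi>(1,2) gh nat_le_linear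
      unfolding \<phi>_def by metis
    thus "g = h" using \<pi>(4) gh by metis
  qed
  moreover have "\<phi> ` B \<subseteq> monics e"
  proof (rule image_subsetI)
    fix g assume g: "g \<in> B"
    have nz: "\<pi> g \<noteq> 0" using \<pi>(1)[OF g] by auto
    have "lead_coeff (\<phi> g) = 1"
      unfolding \<phi>_def lead_coeff_mult \<pi>(2)[OF g] by (simp add: degree_monom_eq)
    moreover have "degree (\<phi> g) = e"
      unfolding \<phi>_def using nz \<pi>(3)[OF g] by (simp add: degree_mult_eq monom_eq_0_iff degree_monom_eq)
    ultimately show "\<phi> g \<in> monics e" by (simp add: monics_def)
  qed
  ultimately have "card B \<le> card (monics e :: 'a poly set)" by (intro card_inj_on_le) auto
  hence cardB: "card B \<le> CARD('a) ^ e" by (simp add: card_monics)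
  have "(\<Sum>g\<in>(primary_polys d :: 'a poly set). d - base_degree g) = (\<Sum>g\<in>B. d - base_degree g)"
    by (intro sum.mono_neutral_right) (auto simp: B_def)
  also have "\<dots> \<le> (\<Sum>g\<in>B. d)" by (intro sum_mono) simp
  also have "\<dots> \<le> d * CARD('a) ^ e" using cardB by simp
  finally show ?thesis unfolding e_def .
qed

lemma card_primary_polys_ge:
  assumes "d \<ge> 1"
  shows "real CARD('a) ^ d / real d \<le> real (card (primary_polys d :: 'a::{field,finite} poly set))"
proof -
  have "CARD('a) ^ d = (\<Sum>g\<in>(primary_polys d :: 'a poly set). base_degree g)"
    by (rule sum_base_degree_primary_polys[OF assms, symmetric])
  also have "\<dots> \<le> (\<Sum>g\<in>(primary_polys d :: 'a poly set). d)"
    by (intro sum_mono base_degree_le)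
  finally have "real (CARD('a) ^ d) \<le> real (card (primary_polys d :: 'a poly set) * d)"
    by (simp only: of_nat_le_iff) simp
  thus ?thesis using assms by (simp add: field_simps)
qed

section \<open>Characters of the unit group and the bound on their eigenvalues\<close>

lemma mult_characters_iff:
  "\<chi> \<in> mult_characters \<longleftrightarrow> (\<forall>x. x \<noteq> 0 \<longrightarrow> \<chi> x \<noteq> 0) \<and> (\<forall>x y. x \<noteq> 0 \<longrightarrow> y \<noteq> 0 \<longrightarrow> \<chi> (x * y) = \<chi> x * \<chi> y)"
  by (auto simp: mult_characters_def hom_def mult_grp_def Pi_def)

text \<open>Elements of \<open>mult_characters\<close> are arbitrary at 0; the value 0 there makes
  them multiplicative on the whole field.\<close>

definition extend_by_zero :: "('b::field \<Rightarrow> complex) \<Rightarrow> 'b \<Rightarrow> complex" where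
  "extend_by_zero \<chi> z = (if z = 0 then 0 else \<chi> z)"

text \<open>Values on units are roots of unity because \<open>z ^ CARD('b) = z\<close>.
  Multiplication by \<open>u\<close> permutes the field and scales the sum by
  \<open>\<chi> u\<close>, which is not 1.\<close>

lemma
  fixes \<chi> :: "'b::{field,finite} \<Rightarrow> complex"
  assumes \<chi>: "\<chi> \<in> mult_characters"
  shows extend_by_zero_mult: "extend_by_zero \<chi> (x * y) = extend_by_zero \<chi> x * extend_by_zero \<chi> y"
    and extend_by_zero_norm: "z \<noteq> 0 \<Longrightarrow> cmod (extend_by_zero \<chi> z) = 1"
    and extend_by_zero_sum: "u \<noteq> 0 \<Longrightarrow> \<chi> u \<noteq> 1 \<Longrightarrow> (\<Sum>z\<in>UNIV. extend_by_zero \<chi> z) = 0"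
proof -
  have mult: "extend_by_zero \<chi> (x * y) = extend_by_zero \<chi> x * extend_by_zero \<chi> y" for x y
    using \<chi> by (auto simp: mult_characters_iff extend_by_zero_def)
  thus "extend_by_zero \<chi> (x * y) = extend_by_zero \<chi> x * extend_by_zero \<chi> y" .
  have nz: "extend_by_zero \<chi> z \<noteq> 0" if "z \<noteq> 0" for z
    using \<chi> that by (auto simp: mult_characters_iff extend_by_zero_def)
  have "extend_by_zero \<chi> 1 = 1" using mult[of 1 1] nz[of 1] by simp
  hence power: "extend_by_zero \<chi> (z ^ k) = extend_by_zero \<chi> z ^ k" for z k by (induction k) (simp_all add: mult)
  show "cmod (extend_by_zero \<chi> z) = 1" if "z \<noteq> 0"
  proof -
    have "extend_by_zero \<chi> z ^ CARD('b) = extend_by_zero \<chi> z" using power[of z "CARD('b)"] by (simp add: power_CARD_field)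
    hence "extend_by_zero \<chi> z * extend_by_zero \<chi> z ^ (CARD('b) - 1) = extend_by_zero \<chi> z * 1" by (simp flip: power_Suc)
    hence "extend_by_zero \<chi> z ^ (CARD('b) - 1) = 1" using nz[OF that] by (simp only: mult_cancel_left) simp
    hence "cmod (extend_by_zero \<chi> z) ^ (CARD('b) - 1) = 1" by (metis norm_power norm_one)
    moreover have "CARD('b) - 1 > 0" using CARD_field_ge_2[where 'a = 'b] by simp
    ultimately show ?thesis
      using power_eq_imp_eq_base[of "cmod (extend_by_zero \<chi> z)" "CARD('b) - 1" 1] by simp
  qed
  show "(\<Sum>z\<in>UNIV. extend_by_zero \<chi> z) = 0" if u: "u \<noteq> 0" "\<chi> u \<noteq> 1"
  proof -
    have "(\<Sum>z\<in>UNIV. extend_by_zero \<chi> z) = (\<Sum>z\<in>UNIV. extend_by_zero \<chi> (u * z))"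
      by (rule sum.reindex_bij_witness[of _ "\<lambda>z. u * z" "\<lambda>z. z / u"]) (use u in auto)
    also have "\<dots> = extend_by_zero \<chi> u * (\<Sum>z\<in>UNIV. extend_by_zero \<chi> z)" by (simp add: mult sum_distrib_left)
    finally show ?thesis using u by (simp add: extend_by_zero_def)
  qed
qed

lemma character_eigenvalue_bound:
  fixes \<iota> :: "'a::{field,finite} \<Rightarrow> 'b::{field,finite}" and f :: "'a poly"
  assumes hom: "field_hom \<iota>" and card: "CARD('b) = CARD('a) ^ n" and n: "n > 1" and d: "1 \<le> d" "d < n"
    and f: "irreducible f" "degree f = n" "eval_at \<iota> \<alpha> f = 0"
    and bound: "real n + real d - 1 \<le> real CARD('a) powr (real d / 2) * (1 - \<delta>)"
    and \<chi>: "\<chi> \<in> mult_characters" and u: "u \<noteq> 0" "\<chi> u \<noteq> 1"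
  shows "cmod (\<Sum>g\<in>primary_polys d. \<chi> (eval_at \<iota> \<alpha> g)) \<le> real CARD('a) ^ d / real d * (1 - \<delta>)"
proof -
  define \<chi>' where "\<chi>' = extend_by_zero \<chi>"
  define q where "q = real CARD('a)"
  define A where "A = (\<Sum>g\<in>primary_polys d. \<chi>' (eval_at \<iota> \<alpha> g))"
  define S where "S = (\<Sum>g\<in>primary_polys d. of_nat (base_degree g) * \<chi>' (eval_at \<iota> \<alpha> g))"
  have q: "q \<ge> 2" using CARD_field_ge_2[where 'a = 'a] by (simp add: q_def)
  have \<chi>'0: "\<chi>' 0 = 0" by (simp add: \<chi>'_def extend_by_zero_def)
  note \<chi>'_props = extend_by_zero_mult[OF \<chi>, folded \<chi>'_def] extend_by_zero_norm[OF \<chi>, folded \<chi>'_def]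
    extend_by_zero_sum[OF \<chi> u, folded \<chi>'_def]
  have "cmod S \<le> real (n - 1) * sqrt q ^ d"
    unfolding S_def q_def
    using n by (intro character_sum_primary_bound[OF hom card _ f \<chi>'0 \<chi>'_props d(1)]) simp
  have "of_nat d * A = S + (\<Sum>g\<in>primary_polys d. of_nat (d - base_degree g) * \<chi>' (eval_at \<iota> \<alpha> g))"
    unfolding A_def S_def sum_distrib_left sum.distrib[symmetric]
  proof (rule sum.cong[OF refl])
    fix g :: "'a poly" assume "g \<in> primary_polys d"
    hence "of_nat d = (of_nat (base_degree g) + of_nat (d - base_degree g) :: complex)"
      using base_degree_le[of g d] by (simp flip: of_nat_add)
    thus "of_nat d * \<chi>' (eval_at \<iota> \<alpha> g) = of_nat (base_degree g) * \<chi>' (eval_at \<iota> \<alpha> g)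
        + of_nat (d - base_degree g) * \<chi>' (eval_at \<iota> \<alpha> g)"
      by (simp only: distrib_right)
  qed
  also have "cmod \<dots> \<le> cmod S + (\<Sum>g\<in>(primary_polys d :: 'a poly set). real (d - base_degree g))"
  proof (rule norm_triangle_mono[OF order.refl sum_norm_le])
    fix g :: "'a poly"
    have "cmod (\<chi>' (eval_at \<iota> \<alpha> g)) \<le> 1"
      using \<chi>'_props(2)[of "eval_at \<iota> \<alpha> g"] by (cases "eval_at \<iota> \<alpha> g = 0") (auto simp: \<chi>'0)
    thus "cmod (of_nat (d - base_degree g) * \<chi>' (eval_at \<iota> \<alpha> g)) \<le> real (d - base_degree g)"
      by (simp add: norm_mult mult_left_le)
  qed
  also have "(\<Sum>g\<in>(primary_polys d :: 'a poly set). real (d - base_degree g)) \<le> real (d * CARD('a) ^ (d div 2))"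
    unfolding of_nat_sum[symmetric] of_nat_le_iff by (rule sum_base_degree_defect_le)
  also have "\<dots> = real d * sqrt q ^ (2 * (d div 2))"
    using q by (simp add: power_mult q_def)
  also have "\<dots> \<le> real d * sqrt q ^ d"
    using q by (intro mult_left_mono power_increasing) (auto simp: real_le_rsqrt)
  also note \<open>cmod S \<le> real (n - 1) * sqrt q ^ d\<close>
  also have "real (n - 1) * sqrt q ^ d + real d * sqrt q ^ d = (real n + real d - 1) * sqrt q ^ d"
    using n by (simp add: of_nat_diff algebra_simps)
  \<comment> \<open>The hypothesis \<open>bound\<close> absorbs \<open>n + d - 1\<close> into one
    factor \<open>sqrt q ^ d\<close>, and two such factors give \<open>q ^ d\<close>.\<close>
  also have "\<dots> \<le> (sqrt q ^ d * (1 - \<delta>)) * sqrt q ^ d"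
  proof (rule mult_right_mono)
    have "q powr (real d / 2) = (q powr (1 / 2)) powr real d" by (simp add: powr_powr)
    also have "\<dots> = sqrt q ^ d" using q by (simp add: powr_half_sqrt powr_realpow)
    finally show "real n + real d - 1 \<le> sqrt q ^ d * (1 - \<delta>)" using bound by (simp add: q_def)
  qed (use q in simp)
  also have "\<dots> = q ^ d * (1 - \<delta>)"
    using q by (simp flip: power_mult_distrib)
  finally have "real d * cmod A \<le> q ^ d * (1 - \<delta>)" by (simp only: norm_mult norm_of_nat)
  hence "cmod A * real d \<le> q ^ d * (1 - \<delta>)" by (simp only: mult.commute)
  moreover have "real d > 0" using d by simp
  ultimately have "cmod A \<le> q ^ d * (1 - \<delta>) / real d" by (simp only: pos_le_divide_eq)
  also have "\<dots> = q ^ d / real d * (1 - \<delta>)" by (rule times_divide_eq_left[symmetric])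
  finally have "cmod A \<le> q ^ d / real d * (1 - \<delta>)" .
  moreover have "A = (\<Sum>g\<in>primary_polys d. \<chi> (eval_at \<iota> \<alpha> g))"
    unfolding A_def using eval_at_primary_polys(1)[OF hom f(1,3)] d f(2)
    by (intro sum.cong) (auto simp: \<chi>'_def extend_by_zero_def)
  ultimately show ?thesis by (simp only: q_def)
qed

section \<open>Fourier analysis on the unit group\<close>

lemma finite_field_units_cyclic:
  obtains \<gamma> :: "'b::{field,finite}" where "\<gamma> \<noteq> 0" "UNIV - {0} = range (\<lambda>i::nat. \<gamma> ^ i)"
proof -
  define R :: "'b ring" where "R = ring_of_type_algebra"
  have field: "field R" unfolding R_def by (rule field_from_type_algebra)
  have carrier: "carrier (Multiplicative_Group.mult_of R) = UNIV - {0}"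
    by (simp add: R_def ring_of_type_algebra_def Multiplicative_Group.carrier_mult_of)
  have pow: "a [^]\<^bsub>R\<^esub> (i :: nat) = a ^ i" for a :: 'b and i
    by (induction i) (simp_all add: nat_pow_def R_def ring_of_type_algebra_def mult.commute)
  have "finite (carrier R)" by (simp add: R_def ring_of_type_algebra_def)
  from field.finite_field_mult_group_has_gen[OF field this]
  have "\<exists>\<gamma>\<in>UNIV - {0 :: 'b}. UNIV - {0} = range (\<lambda>i::nat. \<gamma> ^ i)"
    unfolding carrier pow full_SetCompr_eq Setcompr_eq_image .
  then obtain \<gamma> :: 'b where \<gamma>: "\<gamma> \<in> UNIV - {0} \<and> UNIV - {0} = range (\<lambda>i::nat. \<gamma> ^ i)"
    unfolding Bex_def by (elim exE) (rule that)
  have "\<gamma> \<noteq> 0" using conjunct1[OF \<gamma>] by simp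
  thus ?thesis by (rule that) (rule conjunct2[OF \<gamma>])
qed

lemma finite_field_has_generator:
  obtains \<gamma> :: "'b::{field,finite}" where "\<gamma> \<noteq> 0" "bij_betw (\<lambda>i. \<gamma> ^ i) {..<CARD('b) - 1} (UNIV - {0})"
proof -
  obtain \<gamma> :: 'b where \<gamma>: "\<gamma> \<noteq> 0" and \<gamma>2: "UNIV - {0} = range (\<lambda>i. \<gamma> ^ i)"
    by (rule finite_field_units_cyclic)
  define M where "M = CARD('b) - 1"
  have M: "M > 0" using CARD_field_ge_2[where 'a = 'b] by (simp add: M_def)
  have "\<gamma> * \<gamma> ^ M = \<gamma> * 1" using power_CARD_field[of \<gamma>] by (simp add: M_def flip: power_Suc)
  hence \<gamma>M: "\<gamma> ^ M = 1" using \<gamma> by (simp only: mult_cancel_left) simp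
  have img: "(\<lambda>i. \<gamma> ^ i) ` {..<M} = UNIV - {0}"
  proof (intro equalityI subsetI)
    fix x :: 'b assume "x \<in> UNIV - {0}"
    hence "x \<in> range (\<lambda>i. \<gamma> ^ i)" by (simp only: \<gamma>2)
    then obtain i where "x = \<gamma> ^ i" by blast
    also have "\<dots> = \<gamma> ^ (M * (i div M) + i mod M)" by simp
    also have "\<dots> = \<gamma> ^ (i mod M)" by (simp only: power_add power_mult \<gamma>M power_one mult_1)
    finally have "x = \<gamma> ^ (i mod M)" .
    thus "x \<in> (\<lambda>i. \<gamma> ^ i) ` {..<M}" using M by (intro image_eqI[of _ _ "i mod M"]) simp_all
  next
    fix x assume "x \<in> (\<lambda>i. \<gamma> ^ i) ` {..<M}"
    then obtain i where "x = \<gamma> ^ i" by blast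
    thus "x \<in> UNIV - {0}" using \<gamma> by simp
  qed
  have "inj_on (\<lambda>i. \<gamma> ^ i) {..<M}"
  proof (rule eq_card_imp_inj_on)
    have "card (UNIV - {0 :: 'b}) = M" by (simp add: M_def)
    thus "card ((\<lambda>i. \<gamma> ^ i) ` {..<M}) = card {..<M}" by (simp only: img card_lessThan)
  qed simp
  hence "bij_betw (\<lambda>i. \<gamma> ^ i) {..<M} (UNIV - {0})"
    using img unfolding bij_betw_def by (rule conjI)
  thus ?thesis using that[OF \<gamma>] by (simp only: M_def)
qed

text \<open>In terms of a generator, characters correspond to \<open>M\<close>-th roots of unity
  \<open>z\<close>, where \<open>M = CARD('b) - 1\<close>, and the sum of \<open>h\<close> against a
  character is \<open>poly p z\<close> for a polynomial \<open>p\<close> of degree below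
  \<open>M\<close> whose coefficients are the values of \<open>h\<close>. A nonzero such
  \<open>p\<close> cannot vanish at all \<open>M\<close> roots of unity.\<close>

lemma characters_separate:
  fixes h :: "'b::{field,finite} \<Rightarrow> complex"
  assumes "v \<noteq> 0" "h v \<noteq> 0"
  obtains \<chi> where "\<chi> \<in> mult_characters" "(\<Sum>x\<in>UNIV-{0}. h x * \<chi> x) \<noteq> 0"
proof -
  obtain \<gamma> :: 'b where \<gamma>: "\<gamma> \<noteq> 0" and bij: "bij_betw (\<lambda>i. \<gamma> ^ i) {..<CARD('b) - 1} (UNIV - {0})"
    by (rule finite_field_has_generator)
  define M where "M = CARD('b) - 1"
  have M: "M > 0" using CARD_field_ge_2[where 'a = 'b] by (simp add: M_def)
  have inj: "inj_on (\<lambda>i. \<gamma> ^ i) {..<M}" and img: "(\<lambda>i. \<gamma> ^ i) ` {..<M} = UNIV - {0}"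
    using bij by (auto simp: bij_betw_def M_def)
  define p where "p = (\<Sum>i<M. monom (h (\<gamma> ^ i)) i)"
  have coeff_p: "coeff p i = (if i < M then h (\<gamma> ^ i) else 0)" for i
    by (simp add: p_def coeff_sum)
  obtain i0 where "i0 < M" "v = \<gamma> ^ i0" using img assms(1) by (auto simp: set_eq_iff image_iff)
  hence "p \<noteq> 0" using coeff_p[of i0] assms(2) by auto
  have "degree p < M" using M by (intro degree_lessI) (auto simp: coeff_p)
  have "\<exists>z. z ^ M = 1 \<and> poly p z \<noteq> 0"
  proof (rule ccontr)
    assume "\<not> ?thesis"
    hence "card {z :: complex. z ^ M = 1} \<le> card {z. poly p z = 0}"
      using poly_roots_finite[OF \<open>p \<noteq> 0\<close>] by (intro card_mono) auto
    also have "\<dots> \<le> degree p" by (rule card_poly_roots_bound[OF \<open>p \<noteq> 0\<close>])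
    finally show False using \<open>degree p < M\<close> card_roots_unity_eq[OF M] by simp
  qed
  then obtain z where z: "z ^ M = 1" "poly p z \<noteq> 0" by blast
  \<comment> \<open>The discrete logarithm to base \<open>\<gamma>\<close>; as
    \<open>z ^ M = 1\<close>, only its residue modulo \<open>M\<close> matters for the character
    below.\<close>
  define ind where "ind = the_inv_into {..<M} (\<lambda>i. \<gamma> ^ i)"
  have ind: "\<gamma> ^ ind x = x" if "x \<noteq> 0" for x
    unfolding ind_def using that img by (intro f_the_inv_into_f[OF inj]) auto
  have ind_power: "ind (\<gamma> ^ i) = i" if "i < M" for i
    unfolding ind_def using that by (intro the_inv_into_f_f[OF inj]) auto
  have z_nz: "z \<noteq> 0" using z(1) M by (auto simp: power_0_left)
  have mod_z: "z ^ (i mod M) = z ^ i" for i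
  proof -
    have "z ^ i = z ^ (M * (i div M) + i mod M)" by simp
    also have "\<dots> = z ^ (i mod M)" by (simp only: power_add power_mult z(1) power_one mult_1)
    finally show ?thesis ..
  qed
  have \<gamma>M: "\<gamma> ^ M = 1"
  proof -
    have "\<gamma> * \<gamma> ^ M = \<gamma> * 1" using power_CARD_field[of \<gamma>] by (simp add: M_def flip: power_Suc)
    thus ?thesis using \<gamma> by (simp only: mult_cancel_left) simp
  qed
  have mod_\<gamma>: "\<gamma> ^ (i mod M) = \<gamma> ^ i" for i
  proof -
    have "\<gamma> ^ i = \<gamma> ^ (M * (i div M) + i mod M)" by simp
    also have "\<dots> = \<gamma> ^ (i mod M)" by (simp only: power_add power_mult \<gamma>M power_one mult_1)
    finally show ?thesis ..
  qed
  define \<chi> where "\<chi> = (\<lambda>x. z ^ ind x)"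
  have \<chi>_power: "\<chi> (\<gamma> ^ i) = z ^ i" for i
    using ind_power[of "i mod M"] M mod_z[of i] mod_\<gamma>[of i] by (simp add: \<chi>_def)
  have "\<chi> (x * y) = \<chi> x * \<chi> y" if "x \<noteq> 0" "y \<noteq> 0" for x y
  proof -
    have "\<chi> (x * y) = \<chi> (\<gamma> ^ (ind x + ind y))" using ind that by (simp add: power_add)
    also have "\<dots> = \<chi> x * \<chi> y" unfolding \<chi>_power by (simp add: \<chi>_def power_add)
    finally show ?thesis .
  qed
  hence "\<chi> \<in> mult_characters" using z_nz by (simp add: mult_characters_iff \<chi>_def)
  moreover have "(\<Sum>x\<in>UNIV-{0}. h x * \<chi> x) = poly p z"
  proof -
    have "(\<Sum>x\<in>UNIV-{0}. h x * \<chi> x) = (\<Sum>i<M. h (\<gamma> ^ i) * \<chi> (\<gamma> ^ i))"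
      using sum.reindex_bij_betw[OF bij, of "\<lambda>x. h x * \<chi> x"] by (simp add: M_def)
    also have "\<dots> = poly p z" by (simp add: \<chi>_power p_def poly_sum poly_monom)
    finally show ?thesis .
  qed
  ultimately show ?thesis using that z(2) by metis
qed

text \<open>Summing the eigenvalue equation against a character \<open>\<chi>\<close> that is not
  orthogonal to \<open>h\<close> and substituting \<open>x * eval_at \<iota> \<alpha> g\<close>
  moves the operator onto \<open>\<chi>\<close>, so \<open>\<mu>\<close> is the character sum of the
  inverse of \<open>\<chi>\<close>. As \<open>h\<close> has sum zero, \<open>\<chi>\<close> cannot
  be trivial.\<close>

lemma sum_zero_eigenvalue_is_character_sum:
  fixes \<iota> :: "'a::{field,finite} \<Rightarrow> 'b::{field,finite}"
  assumes nz: "\<And>g. g \<in> primary_polys d \<Longrightarrow> eval_at \<iota> \<alpha> g \<noteq> 0"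
    and h: "v \<noteq> 0" "h v \<noteq> 0" "(\<Sum>x\<in>UNIV-{0}. h x) = 0"
    and eig: "\<And>x. x \<noteq> 0 \<Longrightarrow> adj_op \<iota> \<alpha> d h x = \<mu> * h x"
  obtains \<chi> u where "\<chi> \<in> mult_characters" "u \<noteq> 0" "\<chi> u \<noteq> 1"
    "\<mu> = (\<Sum>g\<in>primary_polys d. \<chi> (eval_at \<iota> \<alpha> g))"
proof -
  obtain \<chi> where \<chi>: "\<chi> \<in> mult_characters" and c: "(\<Sum>x\<in>UNIV-{0}. h x * \<chi> x) \<noteq> 0"
    using characters_separate[of v h, OF h(1,2)] .
  define \<chi>i where "\<chi>i = (\<lambda>x. inverse (\<chi> x))"
  have \<chi>_nz: "\<chi> x \<noteq> 0" and \<chi>_mult: "y \<noteq> 0 \<Longrightarrow> \<chi> (x * y) = \<chi> x * \<chi> y" if "x \<noteq> 0" for x y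
    using \<chi> that by (auto simp: mult_characters_iff)
  have \<chi>i: "\<chi>i \<in> mult_characters" using \<chi> by (auto simp: mult_characters_iff \<chi>i_def)
  have "\<mu> * (\<Sum>x\<in>UNIV-{0}. h x * \<chi> x) = (\<Sum>x\<in>UNIV-{0}. adj_op \<iota> \<alpha> d h x * \<chi> x)"
    unfolding sum_distrib_left by (intro sum.cong) (auto simp: eig)
  also have "\<dots> = (\<Sum>g\<in>primary_polys d. \<Sum>x\<in>UNIV-{0}. h (x * eval_at \<iota> \<alpha> g) * \<chi> x)"
    unfolding adj_op_def sum_distrib_right by (rule sum.swap)
  also have "\<dots> = (\<Sum>g\<in>primary_polys d. \<chi>i (eval_at \<iota> \<alpha> g) * (\<Sum>x\<in>UNIV-{0}. h x * \<chi> x))"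
  proof (rule sum.cong[OF refl])
    fix g :: "'a poly" assume g: "g \<in> primary_polys d"
    define y where "y = eval_at \<iota> \<alpha> g"
    have y: "y \<noteq> 0" using nz[OF g] by (simp add: y_def)
    have "(\<Sum>x\<in>UNIV-{0}. h (x * y) * \<chi> x) = (\<Sum>x\<in>UNIV-{0}. \<chi>i y * (h x * \<chi> x))"
    proof (rule sum.reindex_bij_witness[of _ "\<lambda>x. x / y" "\<lambda>x. x * y"])
      fix x assume "x \<in> UNIV - {0 :: 'b}"
      thus "\<chi>i y * (h (x * y) * \<chi> (x * y)) = h (x * y) * \<chi> x"
        using \<chi>_mult[of x y] \<chi>_nz[OF y] y by (simp add: \<chi>i_def)
    qed (use y in auto)
    thus "(\<Sum>x\<in>UNIV-{0}. h (x * eval_at \<iota> \<alpha> g) * \<chi> x)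
        = \<chi>i (eval_at \<iota> \<alpha> g) * (\<Sum>x\<in>UNIV-{0}. h x * \<chi> x)"
      by (simp add: y_def sum_distrib_left)
  qed
  also have "\<dots> = (\<Sum>g\<in>primary_polys d. \<chi>i (eval_at \<iota> \<alpha> g)) * (\<Sum>x\<in>UNIV-{0}. h x * \<chi> x)"
    by (rule sum_distrib_right[symmetric])
  finally have "\<mu> = (\<Sum>g\<in>primary_polys d. \<chi>i (eval_at \<iota> \<alpha> g))" using c by simp
  moreover have "\<exists>u. u \<noteq> 0 \<and> \<chi>i u \<noteq> 1"
  proof (rule ccontr)
    assume "\<not> ?thesis"
    hence "\<chi> u = 1" if "u \<noteq> 0" for u using that by (auto simp: \<chi>i_def)
    hence "(\<Sum>x\<in>UNIV-{0}. h x * \<chi> x) = (\<Sum>x\<in>UNIV-{0}. h x)" by (intro sum.cong) auto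
    thus False using c h(3) by simp
  qed
  ultimately show ?thesis using that \<chi>i by blast
qed

section \<open>Eigenvalue bounds and expansion of the Cayley graph\<close>

theorem theorem18:
  fixes \<iota> :: "'a::{field,finite} \<Rightarrow> 'b::{field,finite}"
    and f :: "'a poly" and \<alpha> :: 'b and n d :: nat and \<delta> :: real
  assumes "field_hom \<iota>"
    and "CARD('b) = CARD('a) ^ n"
    and "n > 1" and "1 \<le> d" and "d < n"
    and "irreducible f" and "degree f = n" and "eval_at \<iota> \<alpha> f = 0"
    and "0 < \<delta>" and "\<delta> < 1"
    and "real n + real d - 1 \<le> real CARD('a) powr (real d / 2) * (1 - \<delta>)"
  shows "(\<forall>\<mu>. nontrivial_eigenvalue \<iota> \<alpha> d \<mu> \<longrightarrow>
            cmod \<mu> \<le> real CARD('a) ^ d / real d * (1 - \<delta>))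
    \<and> real CARD('a) ^ d / real d * (1 - \<delta>)
        \<le> real (card (primary_polys d :: 'a poly set)) * (1 - \<delta>)
    \<and> (\<forall>\<mu>. trivial_eigenvalue \<iota> \<alpha> d \<mu> \<longrightarrow>
          complex_of_real (real (card (primary_polys d :: 'a poly set)) * (1 - \<delta>))
            = \<mu> * complex_of_real (1 - \<delta>))
    \<and> spectral_expander \<delta> (cayley_digraph \<iota> \<alpha> d)"
proof (intro conjI allI impI)
  note nz = eval_at_primary_polys(1)[OF assms(1,6,8), of d, unfolded assms(7), OF assms(5)]
  note inj = eval_at_primary_polys(2)[OF assms(1,6,8), of d, unfolded assms(7), OF assms(5)]
  have eigenvalue_iff: "char_eigenvalue \<iota> \<alpha> d \<chi> \<mu> \<longleftrightarrow>
      \<chi> \<in> mult_characters \<and> \<mu> = (\<Sum>g\<in>primary_polys d. \<chi> (eval_at \<iota> \<alpha> g))" for \<chi> \<mu>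
    by (rule char_eigenvalue_iff) (rule nz)
  define k where "k = card (primary_polys d :: 'a poly set)"
  have char_bound: "cmod (\<Sum>g\<in>primary_polys d. \<chi> (eval_at \<iota> \<alpha> g)) \<le> real CARD('a) ^ d / real d * (1 - \<delta>)"
    if "\<chi> \<in> mult_characters" "u \<noteq> 0" "\<chi> u \<noteq> 1" for \<chi> u
    by (rule character_eigenvalue_bound[OF assms(1-8,11) that])
  show card_bound: "real CARD('a) ^ d / real d * (1 - \<delta>) \<le> real (card (primary_polys d :: 'a poly set)) * (1 - \<delta>)"
    using card_primary_polys_ge[OF assms(4), where 'a = 'a] assms(10) by (intro mult_right_mono) auto
  {
    fix \<mu> assume "nontrivial_eigenvalue \<iota> \<alpha> d \<mu>"
    then obtain \<chi> x where \<chi>: "\<chi> \<in> mult_characters" "\<mu> = (\<Sum>g\<in>primary_polys d. \<chi> (eval_at \<iota> \<alpha> g))"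
        and x: "x \<in> conn_subgroup \<iota> \<alpha> d" "\<chi> x \<noteq> 1"
      unfolding nontrivial_eigenvalue_def eigenvalue_iff by blast
    \<comment> \<open>Characters are unconstrained at 0, so the witness from the connection subgroup
      must be recognised as a unit before the bound applies.\<close>
    have "x \<noteq> 0"
    proof -
      have "group (mult_grp :: 'b monoid)"
        by (rule groupI) (auto simp: mult_grp_def intro!: bexI[of _ "inverse _"])
      moreover have "conn_set \<iota> \<alpha> d \<subseteq> carrier mult_grp"
        using nz by (auto simp: conn_set_def mult_grp_def)
      ultimately have "x \<in> carrier mult_grp"
        by (rule group.generate_in_carrier) (use x(1) in \<open>simp add: conn_subgroup_def\<close>)
      thus ?thesis by (simp add: mult_grp_def)
    qed
    thus "cmod \<mu> \<le> real CARD('a) ^ d / real d * (1 - \<delta>)"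
      using char_bound[OF \<chi>(1) _ x(2)] \<chi>(2) by simp
  }
  {
    fix \<mu> assume "trivial_eigenvalue \<iota> \<alpha> d \<mu>"
    thus "complex_of_real (real (card (primary_polys d :: 'a poly set)) * (1 - \<delta>)) = \<mu> * complex_of_real (1 - \<delta>)"
      using trivial_eigenvalue_iff[of d \<iota> \<alpha> \<mu>] nz by simp
  }
  define G where "G = cayley_digraph \<iota> \<alpha> d"
  have verts: "verts G = UNIV - {0}" by (simp add: G_def cayley_digraph_def mult_grp_def)
  have "fin_digraph G"
    by unfold_locales (auto simp: G_def cayley_digraph_def mult_grp_def)
  moreover have "verts G \<noteq> {}" unfolding verts using one_neq_zero[where 'a = 'b] by blast
  moreover have "k > 0"
  proof -
    have "0 < real CARD('a) ^ d / real d" using assms(4) by simp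
    also have "\<dots> \<le> real k" unfolding k_def by (rule card_primary_polys_ge[OF assms(4)])
    finally show ?thesis by simp
  qed
  \<comment> \<open>Arcs at \<open>v\<close> are indexed by primary polynomials: \<open>g\<close>
    gives the arc to \<open>v * eval_at \<iota> \<alpha> g\<close> and the arc from
    \<open>v / eval_at \<iota> \<alpha> g\<close>, without repetition because evaluation is
    injective in degree \<open>d < n\<close>.\<close>
  moreover have "out_degree G v = k \<and> in_degree G v = k" if "v \<in> verts G" for v
  proof -
    have v: "v \<noteq> 0" using that by (simp add: verts)
    have "out_arcs G v = (\<lambda>g. (v, v * eval_at \<iota> \<alpha> g)) ` primary_polys d"
      using v nz by (force simp: out_arcs_def G_def cayley_digraph_def conn_set_def mult_grp_def field_simps)
    moreover have "inj_on (\<lambda>g. (v, v * eval_at \<iota> \<alpha> g)) (primary_polys d)"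
      using v inj by (auto simp: inj_on_def)
    moreover have "in_arcs G v = (\<lambda>g. (v / eval_at \<iota> \<alpha> g, v)) ` primary_polys d"
      using v nz by (force simp: in_arcs_def G_def cayley_digraph_def conn_set_def mult_grp_def field_simps)
    moreover have "inj_on (\<lambda>g. (v / eval_at \<iota> \<alpha> g, v)) (primary_polys d)"
      using v inj nz by (auto simp: inj_on_def field_simps)
    ultimately show ?thesis by (simp add: out_degree_def in_degree_def card_image k_def)
  qed
  moreover have "cmod \<mu> \<le> (1 - \<delta>) * real k"
    if h: "\<exists>v\<in>verts G. h v \<noteq> 0" "(\<Sum>v\<in>verts G. h v) = 0" "\<forall>v\<in>verts G. digraph_adj G h v = \<mu> * h v" for \<mu> h
  proof -
    from h(1) obtain v where v: "v \<noteq> 0" "h v \<noteq> 0" by (auto simp: verts)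
    have "adj_op \<iota> \<alpha> d h x = \<mu> * h x" if "x \<noteq> 0" for x
      using h(3) that digraph_adj_cayley_digraph[OF assms(1,6,8), of d x h] assms(5,7)
      by (simp add: verts G_def[symmetric] mult_grp_def)
    from sum_zero_eigenvalue_is_character_sum[OF nz v h(2)[unfolded verts] this]
    obtain \<chi> u where "\<chi> \<in> mult_characters" "u \<noteq> 0" "\<chi> u \<noteq> 1"
        "\<mu> = (\<Sum>g\<in>primary_polys d. \<chi> (eval_at \<iota> \<alpha> g))" by blast
    with char_bound[of \<chi> u] card_bound show ?thesis by (simp add: k_def mult.commute)
  qed
  ultimately show "spectral_expander \<delta> (cayley_digraph \<iota> \<alpha> d)"
    unfolding spectral_expander_def G_def[symmetric] using assms(9) by blast
qed

end
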